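(* Let $d\ge2$ and $A\in\mathbb{N}$. Let $\{(G_\nu,S_\nu,|\cdot|_\nu)\}_{\nu\in\mathbb{N}}$ be a non-$\ell_1$-expanding similar family of groups of automorphisms of $T_d$ such that $S_\nu\subseteq\mathcal{I}_\infty^\nu$ and $|S_\nu|\le A$ for every $\nu\in\mathbb{N}$, and let $\Omega_\nu(n)$ be the sphere of radius $n$ in $G_\nu$ with respect to the pseudometric induced by $|\cdot|_\nu$. If there exists a subexponential function $\delta\colon\mathbb{N}\to\mathbb{N}$ with $\ln(\delta)$ concave such that for infinitely many $\nu\in\mathbb{N}$ one has $|\mathcal{I}_\infty^\nu\cap\Omega_\nu(n)|\le\delta(n)$ for all $n\in\mathbb{N}$, then $G_\nu$ is of subexponential growth for every $\nu\in\mathbb{N}$.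
   Context: $T_d$ is the $d$-regular rooted tree (vertices: finite words over $\{1,\dots,d\}$). $\mathrm{Sym}(d)$ acts by rooted automorphisms $\tau(xw)=\tau(x)w$, and every $g\in\mathrm{Aut}(T_d)$ is uniquely written $g=(g_1,\dots,g_d)\tau$ with $\tau\in\mathrm{Sym}(d)$ and $g_i$ the restriction of $g\tau^{-1}$ to the subtree at vertex $i$. A pseudolength on a finite symmetric generating set $S$ of $G$ is a map $S\to\{0,1\}$; the associated word pseudonorm is $|g|=\min\{\sum_i|s_i| : g=s_1\cdots s_k, s_i\in S\}$, with pseudometric $d(g,h)=|g^{-1}h|$; it is proper if the subgroup generated by length-$0$ generators is finite. A non-$\ell_1$-expanding similar family is a family $\{(G_\nu,S_\nu,|\cdot|_\nu)\}_{\nu\in\mathbb{N}}$ where each $G_\nu\le\mathrm{Aut}(T_d)$ acts transitively on each level of $T_d$, is generated by the finite symmetric set $S_\nu$ and carries a proper word pseudonorm $|\cdot|_\nu$, such that every $g\in G_\nu$ is $g=(g_1,\dots,g_d)\tau$ with $g_i\in G_{\nu+1}$, $\tau\in\mathrm{Sym}(d)$ and $\sum_{i=1}^d|g_i|_{\nu+1}\le|g|_\nu$. Incompressible elements: $\mathcal{I}_0^\nu=G_\nu$; $\mathcal{I}_k^\nu=\{g=(g_1,\dots,g_d)\tau\in G_\nu : g_i\in\mathcal{I}_{k-1}^{\nu+1}, \sum_i|g_i|_{\nu+1}=|g|_\nu\}$; $\mathcal{I}_\infty^\nu=\bigcap_{k\ge1}\mathcal{I}_k^\nu$. For non-decreasing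 $f,g\colon\mathbb{N}\to\mathbb{N}$, $f\lesssim g$ means $f(n)\le g(Cn)$ for some $C\in\mathbb{N}_{>0}$ and all $n\ge1$, $f\sim g$ means both directions; $f$ is subexponential if $f\lesssim e^n$ and $f\not\sim e^n$; a group is of subexponential growth if its growth function (ball sizes) is subexponential. *)

theory Defs
  imports Complex_Main
begin

type_synonym tmap = "nat list \<Rightarrow> nat list"

text \<open>Vertices of T_d: finite words over the alphabet {0..<d} (0-based relabelling of {1..d}).
  An automorphism is a bijection of all nat lists that is the identity off the tree,
  fixes the root and maps children to children.\<close>
definition tree_aut :: "nat \<Rightarrow> tmap \<Rightarrow> bool" where
  "tree_aut d g \<longleftrightarrow> bij g \<and> (\<forall>w. w \<notin> lists {..<d} \<longrightarrow> g w = w) \<and> g [] = [] \<and>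
     (\<forall>w\<in>lists {..<d}. \<forall>x<d. \<exists>y<d. g (w @ [x]) = g w @ [y])"

definition perm_act :: "nat \<Rightarrow> (nat \<Rightarrow> nat) \<Rightarrow> tmap" where
  "perm_act d \<tau> w = (if w \<in> lists {..<d} \<and> w \<noteq> [] then \<tau> (hd w) # tl w else w)"

text \<open>The root permutation tau of g = (g_1,...,g_d) tau.\<close>
definition root_perm :: "nat \<Rightarrow> tmap \<Rightarrow> nat \<Rightarrow> nat" where
  "root_perm d g x = (if x < d then hd (g [x]) else x)"

definition coord :: "nat \<Rightarrow> tmap \<Rightarrow> nat \<Rightarrow> tmap" where
  "coord d g i w = (if w \<in> lists {..<d}
      then tl ((g \<circ> perm_act d (inv_into {..<d} (root_perm d g))) (i # w)) else w)"

definition eval_word :: "tmap list \<Rightarrow> tmap" where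
  "eval_word ws = foldr (\<circ>) ws id"

definition generated :: "tmap set \<Rightarrow> tmap set" where
  "generated S = {eval_word ws | ws. set ws \<subseteq> S}"

definition word_norm :: "(tmap \<Rightarrow> nat) \<Rightarrow> tmap set \<Rightarrow> tmap \<Rightarrow> nat" where
  "word_norm L S g = (LEAST n. \<exists>ws. set ws \<subseteq> S \<and> eval_word ws = g \<and> sum_list (map L ws) = n)"

definition proper_pseudolength :: "(tmap \<Rightarrow> nat) \<Rightarrow> tmap set \<Rightarrow> bool" where
  "proper_pseudolength L S \<longleftrightarrow> (\<forall>s\<in>S. L s \<le> 1) \<and> finite (generated {s\<in>S. L s = 0})"

definition level_transitive :: "nat \<Rightarrow> tmap set \<Rightarrow> bool" where
  "level_transitive d G \<longleftrightarrow> (\<forall>u\<in>lists {..<d}. \<forall>v\<in>lists {..<d}.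
      length u = length v \<longrightarrow> (\<exists>g\<in>G. g u = v))"

definition non_l1_expanding_similar_family ::
  "nat \<Rightarrow> (nat \<Rightarrow> tmap set) \<Rightarrow> (nat \<Rightarrow> tmap set) \<Rightarrow> (nat \<Rightarrow> tmap \<Rightarrow> nat) \<Rightarrow> bool" where
  "non_l1_expanding_similar_family d G S L \<longleftrightarrow>
     (\<forall>\<nu>. (\<forall>g\<in>G \<nu>. tree_aut d g) \<and> level_transitive d (G \<nu>)
        \<and> finite (S \<nu>) \<and> (\<forall>s\<in>S \<nu>. inv s \<in> S \<nu>) \<and> G \<nu> = generated (S \<nu>)
        \<and> proper_pseudolength (L \<nu>) (S \<nu>)
        \<and> (\<forall>g\<in>G \<nu>. (\<forall>i<d. coord d g i \<in> G (Suc \<nu>)) \<and>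
             (\<Sum>i<d. word_norm (L (Suc \<nu>)) (S (Suc \<nu>)) (coord d g i))
               \<le> word_norm (L \<nu>) (S \<nu>) g))"

fun incompr :: "nat \<Rightarrow> (nat \<Rightarrow> tmap set) \<Rightarrow> (nat \<Rightarrow> tmap set) \<Rightarrow> (nat \<Rightarrow> tmap \<Rightarrow> nat)
    \<Rightarrow> nat \<Rightarrow> nat \<Rightarrow> tmap set" where
  "incompr d G S L 0 \<nu> = G \<nu>"
| "incompr d G S L (Suc k) \<nu> = {g \<in> G \<nu>. (\<forall>i<d. coord d g i \<in> incompr d G S L k (Suc \<nu>)) \<and>
      (\<Sum>i<d. word_norm (L (Suc \<nu>)) (S (Suc \<nu>)) (coord d g i)) = word_norm (L \<nu>) (S \<nu>) g}"

definition incompr_inf :: "nat \<Rightarrow> (nat \<Rightarrow> tmap set) \<Rightarrow> (nat \<Rightarrow> tmap set) \<Rightarrow> (nat \<Rightarrow> tmap \<Rightarrow> nat)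
    \<Rightarrow> nat \<Rightarrow> tmap set" where
  "incompr_inf d G S L \<nu> = (\<Inter>k\<in>{1..}. incompr d G S L k \<nu>)"

text \<open>Sphere of radius n (around the identity) for the pseudometric d(g,h) = |g^{-1}h|.\<close>
definition sphere_pn :: "tmap set \<Rightarrow> (tmap \<Rightarrow> nat) \<Rightarrow> tmap set \<Rightarrow> nat \<Rightarrow> tmap set" where
  "sphere_pn G L S n = {g \<in> G. word_norm L S g = n}"

definition lesssim :: "(nat \<Rightarrow> real) \<Rightarrow> (nat \<Rightarrow> real) \<Rightarrow> bool" where
  "lesssim f g \<longleftrightarrow> (\<exists>C::nat. C > 0 \<and> (\<forall>n\<ge>1. f n \<le> g (C * n)))"

definition subexponential :: "(nat \<Rightarrow> real) \<Rightarrow> bool" where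
  "subexponential f \<longleftrightarrow> mono f \<and> lesssim f (\<lambda>n. exp (real n))
      \<and> \<not> (lesssim f (\<lambda>n. exp (real n)) \<and> lesssim (\<lambda>n. exp (real n)) f)"

definition growth :: "tmap set \<Rightarrow> tmap set \<Rightarrow> nat \<Rightarrow> nat" where
  "growth G S n = card {g \<in> G. word_norm (\<lambda>_. 1) S g \<le> n}"

definition subexp_growth :: "tmap set \<Rightarrow> tmap set \<Rightarrow> bool" where
  "subexp_growth G S \<longleftrightarrow> subexponential (\<lambda>n. real (growth G S n))"

definition concave_seq :: "(nat \<Rightarrow> real) \<Rightarrow> bool" where
  "concave_seq f \<longleftrightarrow> (\<forall>n. f n + f (n + 2) \<le> 2 * f (n + 1))"

end

theory Submission
  imports Defs "HOL-Library.FuncSet"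
begin

text \<open>Let \<open>T\<close> be the infimum of all \<open>t > 0\<close> such that every Poincare series
  \<open>\<Sum>\<^sub>g exp (- t * |g|)\<close>, \<open>g \<in> G \<nu>\<close>, converges; the goal is \<open>T = 0\<close>.
  An element is determined by its root permutation and its coordinates, so convergence for
  \<open>G (\<nu> + k)\<close> gives convergence on \<open>G \<nu>\<close> of the series in which \<open>|g|\<close> is replaced
  by the total norm of the coordinates of \<open>g\<close> at level \<open>k\<close>.
  Cutting a geodesic word greedily writes \<open>g\<close> as \<open>h\<^sub>1 s\<^sub>1 \<dots> h\<^sub>m s\<^sub>m h\<close> with
  incompressible \<open>h\<^sub>i\<close> and \<open>h\<close>, where each \<open>h\<^sub>i s\<^sub>i\<close> either is compressible or has norm
  \<open>R + 1\<close>. If \<open>m\<close> is large compared with \<open>|g| / R\<close>, then a definite proportion of the norm is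
  lost at some level \<open>k\<close>. If \<open>m\<close> is small, then such products are few because the
  incompressible elements grow subexponentially, uniformly for infinitely many \<open>\<nu>\<close>.
  Since \<open>R\<close> depends on \<open>T\<close> only, \<open>T > 0\<close> would allow an exponent below \<open>T\<close> for
  infinitely many \<open>\<nu>\<close>, and hence for all \<open>\<nu>\<close>, as coordinates do not increase the norm.\<close>

section \<open>Words, word norms and finiteness of balls\<close>

lemma eval_word_simps [simp]:
  "eval_word [] = id" "eval_word (x # xs) = x \<circ> eval_word xs"
  "eval_word (xs @ ys) = eval_word xs \<circ> eval_word ys"
proof -
  show *: "eval_word [] = id" "\<And>x xs. eval_word (x # xs) = x \<circ> eval_word xs"
    by (simp_all add: eval_word_def)
  show "eval_word (xs @ ys) = eval_word xs \<circ> eval_word ys"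
    by (induction xs) (simp_all add: * comp_assoc)
qed

lemma generated_comp:
  assumes "g \<in> generated S" "h \<in> generated S"
  shows "g \<circ> h \<in> generated S"
proof -
  obtain xs ys where "set xs \<subseteq> S" "g = eval_word xs" "set ys \<subseteq> S" "h = eval_word ys"
    using assms by (auto simp: generated_def)
  then have "set (xs @ ys) \<subseteq> S" "g \<circ> h = eval_word (xs @ ys)" by auto
  then show ?thesis unfolding generated_def by blast
qed

lemma generated_eval: "set ws \<subseteq> S \<Longrightarrow> eval_word ws \<in> generated S"
  by (auto simp: generated_def)

lemma word_norm_le: "set ws \<subseteq> S \<Longrightarrow> word_norm L S (eval_word ws) \<le> sum_list (map L ws)"
  unfolding word_norm_def by (rule Least_le) blast

lemma word_norm_attained:
  assumes "g \<in> generated S"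
  obtains ws where "set ws \<subseteq> S" "eval_word ws = g" "sum_list (map L ws) = word_norm L S g"
proof -
  obtain ws0 where "set ws0 \<subseteq> S" "eval_word ws0 = g"
    using assms by (auto simp: generated_def)
  then have "\<exists>n ws. set ws \<subseteq> S \<and> eval_word ws = g \<and> sum_list (map L ws) = n" by blast
  then have "\<exists>ws. set ws \<subseteq> S \<and> eval_word ws = g \<and> sum_list (map L ws) = word_norm L S g"
    unfolding word_norm_def by (rule LeastI_ex)
  then show ?thesis using that by blast
qed

lemma word_norm_comp_le:
  assumes "g \<in> generated S" "h \<in> generated S"
  shows "word_norm L S (g \<circ> h) \<le> word_norm L S g + word_norm L S h"
proof -
  obtain xs where xs: "set xs \<subseteq> S" "eval_word xs = g" "sum_list (map L xs) = word_norm L S g"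
    using assms(1) by (rule word_norm_attained)
  obtain ys where ys: "set ys \<subseteq> S" "eval_word ys = h" "sum_list (map L ys) = word_norm L S h"
    using assms(2) by (rule word_norm_attained)
  show ?thesis using word_norm_le[of "xs @ ys" S L] xs ys by auto
qed

lemma word_norm_id [simp]: "word_norm L S id = 0"
  using word_norm_le[of "[]" S L] by simp

text \<open>Subwords of geodesic words are geodesic: each norm is at most its letter sum, and
  subadditivity together with equality for the whole word leaves no room for a strict
  inequality.\<close>

lemma geodesic_split:
  assumes "set (xs @ ys) \<subseteq> S" "sum_list (map L (xs @ ys)) = word_norm L S (eval_word (xs @ ys))"
  shows "sum_list (map L xs) = word_norm L S (eval_word xs)"
    and "sum_list (map L ys) = word_norm L S (eval_word ys)"
proof -
  have "set xs \<subseteq> S" "set ys \<subseteq> S" using assms(1) by auto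
  note le = word_norm_le[OF this(1), of L] word_norm_le[OF this(2), of L]
    word_norm_comp_le[OF generated_eval[OF this(1)] generated_eval[OF this(2)], of L]
  show "sum_list (map L xs) = word_norm L S (eval_word xs)"
    "sum_list (map L ys) = word_norm L S (eval_word ys)"
    using le assms(2) by auto
qed

lemma finite_word_length_ball:
  assumes "finite S"
  shows "finite {g \<in> generated S. word_norm (\<lambda>_. 1) S g \<le> n}"
proof (rule finite_subset)
  show "{g \<in> generated S. word_norm (\<lambda>_. 1) S g \<le> n}
    \<subseteq> eval_word ` {ws. set ws \<subseteq> S \<and> length ws \<le> n}"
  proof safe
    fix g assume "g \<in> generated S" and n: "word_norm (\<lambda>_. 1) S g \<le> n"
    from this(1) obtain ws where "set ws \<subseteq> S" "eval_word ws = g"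
      "sum_list (map (\<lambda>_. 1) ws) = word_norm (\<lambda>_. 1) S g"
      by (rule word_norm_attained)
    with n show "g \<in> eval_word ` {ws. set ws \<subseteq> S \<and> length ws \<le> n}"
      by (auto simp: sum_list_triv)
  qed
  show "finite (eval_word ` {ws. set ws \<subseteq> S \<and> length ws \<le> n})"
    using finite_lists_length_le[OF assms] by blast
qed

text \<open>Properness enters here. A word either has only letters of length 0, hence lies in a
  finite set, or is such a prefix followed by a letter of positive length and a word of smaller sum.
  Stating the claim for words instead of norms lets the induction remove letters.\<close>

lemma finite_word_sum_ball:
  fixes L :: "tmap \<Rightarrow> nat"
  assumes "finite S" "finite (generated {s \<in> S. L s = 0})"
  shows "finite (eval_word ` {ws. set ws \<subseteq> S \<and> sum_list (map L ws) \<le> n})"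
proof (induction n)
  let ?K = "generated {s \<in> S. L s = 0}"
  let ?B = "\<lambda>n. eval_word ` {ws. set ws \<subseteq> S \<and> sum_list (map L ws) \<le> n}"
  case 0
  have "?B 0 \<subseteq> ?K"
    by (auto intro!: generated_eval)
  then show ?case using assms(2) finite_subset by blast
next
  let ?K = "generated {s \<in> S. L s = 0}"
  let ?B = "\<lambda>n. eval_word ` {ws. set ws \<subseteq> S \<and> sum_list (map L ws) \<le> n}"
  case (Suc n)
  have "?B (Suc n) \<subseteq> ?K \<union> (\<lambda>(k, s, b). k \<circ> (s \<circ> b)) ` (?K \<times> S \<times> ?B n)"
  proof
    fix g assume "g \<in> ?B (Suc n)"
    then obtain ws where ws: "set ws \<subseteq> S" "sum_list (map L ws) \<le> Suc n" "g = eval_word ws"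
      by auto
    show "g \<in> ?K \<union> (\<lambda>(k, s, b). k \<circ> (s \<circ> b)) ` (?K \<times> S \<times> ?B n)"
    proof (cases "\<forall>s\<in>set ws. L s = 0")
      case True
      then have "g \<in> ?K" using ws by (auto intro!: generated_eval)
      then show ?thesis by blast
    next
      case False
      then have "\<exists>s\<in>set ws. L s \<noteq> 0" by blast
      then obtain xs s ys where sp: "ws = xs @ s # ys" "L s \<noteq> 0" "\<forall>x\<in>set xs. \<not> L x \<noteq> 0"
        by (rule split_list_first_propE) blast
      have "eval_word xs \<in> ?K" "s \<in> S" "eval_word ys \<in> ?B n"
        using ws sp by (auto intro!: generated_eval)
      moreover have "g = eval_word xs \<circ> (s \<circ> eval_word ys)" using ws sp by simp
      ultimately show ?thesis by force
    qed
  qed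
  moreover have "finite (?K \<union> (\<lambda>(k, s, b). k \<circ> (s \<circ> b)) ` (?K \<times> S \<times> ?B n))"
    using Suc assms by auto
  ultimately show ?case using finite_subset by blast
qed

section \<open>Tree automorphisms: root permutation and coordinates\<close>

text \<open>Extending a word at its end only extends its image at the end, so the first letter of
  the image is already decided by the first letter of the word.\<close>

lemma tree_aut_Cons:
  assumes "tree_aut d g" "x < d" "w \<in> lists {..<d}"
  shows "g (x # w) = root_perm d g x # tl (g (x # w))"
  using assms(3)
proof (induction w rule: rev_induct)
  case Nil
  obtain y where "g ([] @ [x]) = g [] @ [y]"
    using assms(1,2) unfolding tree_aut_def by blast
  then show ?case using assms by (simp add: root_perm_def tree_aut_def)
next
  case (snoc y w)
  have "x # w \<in> lists {..<d}" "y < d" using snoc assms by auto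
  then obtain z where "g ((x # w) @ [y]) = g (x # w) @ [z]"
    using assms(1) unfolding tree_aut_def by blast
  with snoc show ?case by (metis Cons_eq_appendI append_in_lists_conv list.sel(3))
qed

lemma tree_aut_lists:
  assumes "tree_aut d g" "w \<in> lists {..<d}"
  shows "g w \<in> lists {..<d}"
  using assms(2)
proof (induction w rule: rev_induct)
  case Nil
  then show ?case using assms(1) by (simp add: tree_aut_def)
next
  case (snoc y w)
  then obtain z where "z < d" "g (w @ [y]) = g w @ [z]"
    using assms(1) unfolding tree_aut_def by (metis append_in_lists_conv lessThan_iff listsE)
  with snoc show ?case by auto
qed

text \<open>Injectivity of \<open>g\<close> on one-letter words suffices, since an injection of a
  finite set into itself is onto.\<close>

lemma root_perm_bij:
  assumes "tree_aut d g"
  shows "bij_betw (root_perm d g) {..<d} {..<d}"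
proof -
  have sing: "g [x] = [root_perm d g x] \<and> root_perm d g x < d" if "x < d" for x
  proof -
    have "g [] = []" "\<exists>y<d. g ([] @ [x]) = g [] @ [y]"
      using assms(1) that unfolding tree_aut_def by blast+
    then show ?thesis using that by (auto simp: root_perm_def)
  qed
  have "inj g" using assms by (simp add: tree_aut_def bij_def)
  then have "inj_on (root_perm d g) {..<d}"
    using sing by (intro inj_onI) (metis injD[of g] lessThan_iff list.inject)
  moreover have "root_perm d g ` {..<d} \<subseteq> {..<d}" using sing by auto
  ultimately show ?thesis
    by (simp add: bij_betw_def endo_inj_surj)
qed

lemma root_perm_less: "tree_aut d g \<Longrightarrow> x < d \<Longrightarrow> root_perm d g x < d"
  using root_perm_bij[of d g] by (auto simp: bij_betw_def)

text \<open>Coordinates restrict \<open>g\<close> composed with the inverse root permutation, so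
  they are indexed by the target subtree. This form hides that inverse from all later
  arguments.\<close>

lemma coord_root_perm:
  assumes "tree_aut d g" "x < d" "w \<in> lists {..<d}"
  shows "g (x # w) = root_perm d g x # coord d g (root_perm d g x) w"
proof -
  have "inv_into {..<d} (root_perm d g) (root_perm d g x) = x"
    using root_perm_bij[OF assms(1)] assms(2) by (simp add: bij_betw_def)
  then have "coord d g (root_perm d g x) w = tl (g (x # w))"
    using assms root_perm_less[OF assms(1,2)] by (simp add: coord_def perm_act_def)
  then show ?thesis by (metis tree_aut_Cons[OF assms])
qed

lemma root_perm_comp:
  assumes "tree_aut d g" "tree_aut d h" "x < d"
  shows "root_perm d (g \<circ> h) x = root_perm d g (root_perm d h x)"
proof -
  let ?y = "root_perm d h x"
  have "(g \<circ> h) [x] = g (?y # coord d h ?y [])"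
    using coord_root_perm[OF assms(2,3), of "[]"] by simp
  moreover have "?y # coord d h ?y [] \<in> lists {..<d}"
    using coord_root_perm[OF assms(2,3), of "[]"] tree_aut_lists[OF assms(2), of "[x]"] assms(3)
    by auto
  ultimately have "hd ((g \<circ> h) [x]) = root_perm d g ?y"
    using coord_root_perm[OF assms(1) root_perm_less[OF assms(2,3)], of "coord d h ?y []"] by auto
  then show ?thesis using assms(3) by (simp add: root_perm_def)
qed

text \<open>Coordinates of a product are products of coordinates, at permuted indices. Indexing by
  the source vertex \<open>x\<close> avoids inverse permutations; the last assumption keeps the
  intermediate word inside the tree.\<close>

lemma coord_comp:
  assumes "tree_aut d g" "tree_aut d h" "tree_aut d (g \<circ> h)" "x < d"
    and "tree_aut d (coord d h (root_perm d h x))"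
  shows "coord d (g \<circ> h) (root_perm d (g \<circ> h) x)
    = coord d g (root_perm d (g \<circ> h) x) \<circ> coord d h (root_perm d h x)"
proof
  let ?y = "root_perm d h x"
  fix w
  show "coord d (g \<circ> h) (root_perm d (g \<circ> h) x) w
    = (coord d g (root_perm d (g \<circ> h) x) \<circ> coord d h ?y) w"
  proof (cases "w \<in> lists {..<d}")
    case True
    have "(g \<circ> h) (x # w) = g (?y # coord d h ?y w)"
      using coord_root_perm[OF assms(2,4) True] by simp
    also have "\<dots> = root_perm d g ?y # coord d g (root_perm d g ?y) (coord d h ?y w)"
      by (rule coord_root_perm[OF assms(1) root_perm_less[OF assms(2,4)]
            tree_aut_lists[OF assms(5) True]])
    finally show ?thesis
      using coord_root_perm[OF assms(3,4) True] root_perm_comp[OF assms(1,2,4)] by simp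
  next
    case False
    then show ?thesis by (simp add: coord_def)
  qed
qed

text \<open>This injectivity allows elements to be counted by their root permutations and coordinate
  tuples.\<close>

lemma tree_aut_eqI:
  assumes g: "tree_aut d g" and h: "tree_aut d h"
    and root: "\<And>x. x < d \<Longrightarrow> root_perm d g x = root_perm d h x"
    and crd: "\<And>i. i < d \<Longrightarrow> coord d g i = coord d h i"
  shows "g = h"
proof
  fix w
  show "g w = h w"
  proof (cases "w \<in> lists {..<d}")
    case True
    show ?thesis
    proof (cases w)
      case Nil
      then show ?thesis using g h by (simp add: tree_aut_def)
    next
      case (Cons x v)
      then have x: "x < d" "v \<in> lists {..<d}" using True by auto
      show ?thesis
        using coord_root_perm[OF g x] coord_root_perm[OF h x] root[OF x(1)]
          crd[OF root_perm_less[OF g x(1)]] Cons by simp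
    qed
  next
    case False
    then show ?thesis using g h by (simp add: tree_aut_def)
  qed
qed

section \<open>Poincare series and elementary sum estimates\<close>

text \<open>Since all terms are positive, bounded finite partial sums express convergence of the
  Poincare series over \<open>M\<close>. The function \<open>f\<close> is a parameter so that norms
  can be exchanged for level norms.\<close>

definition poincare_bounded :: "'a set \<Rightarrow> ('a \<Rightarrow> nat) \<Rightarrow> real \<Rightarrow> bool" where
  "poincare_bounded M f t \<longleftrightarrow>
    (\<exists>B. \<forall>F. finite F \<and> F \<subseteq> M \<longrightarrow> (\<Sum>g\<in>F. exp (- t * real (f g))) \<le> B)"

lemma poincare_bounded_mono:
  assumes "poincare_bounded M f t" "\<And>g. g \<in> M \<Longrightarrow> t * real (f g) \<le> t' * real (f' g)"
  shows "poincare_bounded M f' t'"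
proof -
  obtain B where B: "\<And>F. finite F \<Longrightarrow> F \<subseteq> M \<Longrightarrow> (\<Sum>g\<in>F. exp (- t * real (f g))) \<le> B"
    using assms(1) by (auto simp: poincare_bounded_def)
  have "(\<Sum>g\<in>F. exp (- t' * real (f' g))) \<le> B" if "finite F" "F \<subseteq> M" for F
  proof -
    have "(\<Sum>g\<in>F. exp (- t' * real (f' g))) \<le> (\<Sum>g\<in>F. exp (- t * real (f g)))"
      by (rule sum_mono) (use assms(2) that in auto)
    then show ?thesis using B[OF that] by simp
  qed
  then show ?thesis by (auto simp: poincare_bounded_def)
qed

lemma poincare_bounded_mono_exponent:
  "poincare_bounded M f t \<Longrightarrow> t \<le> t' \<Longrightarrow> poincare_bounded M f t'"
  by (erule poincare_bounded_mono) (simp add: mult_right_mono)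

lemma poincare_bounded_subset:
  "poincare_bounded M f t \<Longrightarrow> N \<subseteq> M \<Longrightarrow> poincare_bounded N f t"
  unfolding poincare_bounded_def by (meson order_trans)

lemma poincare_bounded_Un:
  assumes "poincare_bounded M f t" "poincare_bounded N f t"
  shows "poincare_bounded (M \<union> N) f t"
proof -
  obtain B where B: "\<And>F. finite F \<Longrightarrow> F \<subseteq> M \<Longrightarrow> (\<Sum>g\<in>F. exp (- t * real (f g))) \<le> B"
    using assms(1) by (auto simp: poincare_bounded_def)
  obtain C where C: "\<And>F. finite F \<Longrightarrow> F \<subseteq> N \<Longrightarrow> (\<Sum>g\<in>F. exp (- t * real (f g))) \<le> C"
    using assms(2) by (auto simp: poincare_bounded_def)
  have "(\<Sum>g\<in>F. exp (- t * real (f g))) \<le> B + C" if F: "finite F" "F \<subseteq> M \<union> N" for F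
  proof -
    have "F = (F \<inter> M) \<union> (F - M)" by auto
    then have "(\<Sum>g\<in>F. exp (- t * real (f g)))
      = (\<Sum>g\<in>F \<inter> M. exp (- t * real (f g))) + (\<Sum>g\<in>F - M. exp (- t * real (f g)))"
      using F(1) by (metis Diff_disjoint Int_Diff_disjoint finite_Diff finite_Int sum.union_disjoint)
    then show ?thesis using B[of "F \<inter> M"] C[of "F - M"] F by fastforce
  qed
  then show ?thesis by (auto simp: poincare_bounded_def)
qed

text \<open>A geometric series: lists of length \<open>k\<close> contribute the \<open>k\<close>-th
  power of \<open>sum f P\<close>. The bound 2 reproduces itself because 1 + 1/2 * 2 = 2.\<close>

lemma sum_prod_list_le_2:
  fixes f :: "'a \<Rightarrow> real"
  assumes P: "finite P" and f: "\<And>x. x \<in> P \<Longrightarrow> 0 \<le> f x" and half: "sum f P \<le> 1/2"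
  shows "(\<Sum>xs\<in>{xs. set xs \<subseteq> P \<and> length xs \<le> n}. prod_list (map f xs)) \<le> 2"
proof (induction n)
  case 0
  have "{xs. set xs \<subseteq> P \<and> length xs \<le> 0} = {[]}" by auto
  then show ?case by simp
next
  case (Suc n)
  let ?U = "\<lambda>n. {xs. set xs \<subseteq> P \<and> length xs \<le> n}"
  have fin: "finite (?U n)" by (rule finite_lists_length_le[OF P])
  have U: "?U (Suc n) = insert [] ((\<lambda>(x, xs). x # xs) ` (P \<times> ?U n))"
  proof (rule set_eqI)
    fix xs show "xs \<in> ?U (Suc n) \<longleftrightarrow> xs \<in> insert [] ((\<lambda>(x, xs). x # xs) ` (P \<times> ?U n))"
      by (cases xs) (auto simp: image_iff)
  qed
  have "(\<Sum>xs\<in>?U (Suc n). prod_list (map f xs))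
    = 1 + (\<Sum>xs\<in>(\<lambda>(x, xs). x # xs) ` (P \<times> ?U n). prod_list (map f xs))"
    unfolding U by (subst sum.insert) (use P fin in auto)
  also have "(\<Sum>xs\<in>(\<lambda>(x, xs). x # xs) ` (P \<times> ?U n). prod_list (map f xs))
    = (\<Sum>(x, xs)\<in>P \<times> ?U n. f x * prod_list (map f xs))"
    by (subst sum.reindex) (auto simp: inj_on_def case_prod_beta)
  also have "\<dots> = sum f P * (\<Sum>xs\<in>?U n. prod_list (map f xs))"
    by (simp add: sum_product sum.cartesian_product)
  also have "\<dots> \<le> 1/2 * 2"
    using Suc half by (intro mult_mono) (auto intro!: sum_nonneg prod_list_nonneg f)
  finally show ?case by simp
qed

text \<open>By concavity the increments of \<open>ln \<delta>\<close> decrease. Once one of them is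
  below \<open>\<epsilon>\<close> all later ones are, and they cannot all stay above
  \<open>\<epsilon>\<close> without making \<open>\<delta>\<close> exponential.\<close>

lemma concave_subexponential_bound:
  fixes \<delta> :: "nat \<Rightarrow> nat"
  assumes sub: "subexponential (\<lambda>n. real (\<delta> n))" and pos: "\<And>n. \<delta> n > 0"
    and conc: "concave_seq (\<lambda>n. ln (real (\<delta> n)))" and e: "\<epsilon> > 0"
  obtains C where "\<And>n. real (\<delta> n) \<le> exp (C + \<epsilon> * real n)"
proof -
  define f where "f n = ln (real (\<delta> n))" for n
  have expf: "real (\<delta> n) = exp (f n)" for n using pos[of n] by (simp add: f_def)
  have f0: "f n \<ge> 0" for n using pos[of n] by (simp add: f_def Suc_le_eq)
  have "decseq (\<lambda>n. f (Suc n) - f n)"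
    using conc by (auto simp: decseq_Suc_iff concave_seq_def f_def algebra_simps)
  then have dec: "f (Suc n) - f n \<le> f (Suc m) - f m" if "m \<le> n" for m n
    using that by (simp add: decseq_def)
  have "\<exists>N. f (Suc N) - f N < \<epsilon>"
  proof (rule ccontr)
    assume "\<not> ?thesis"
    then have ge: "f (Suc n) \<ge> f n + \<epsilon>" for n by (auto simp: not_less algebra_simps)
    have lin: "f n \<ge> \<epsilon> * real n" for n
    proof (induction n)
      case 0 then show ?case using f0 by simp
    next
      case (Suc n) then show ?case using ge[of n] by (simp add: algebra_simps)
    qed
    \<comment> \<open>Dilating the argument by \<open>C\<close> raises the slope
      \<open>\<epsilon>\<close> to at least 1, as the definition of \<open>lesssim\<close>
      permits.\<close>
    obtain C :: nat where C: "1 / \<epsilon> < real C" using reals_Archimedean2 by blast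
    have "C > 0" using C e by (metis divide_pos_pos gr0I less_asym of_nat_0 zero_less_one)
    moreover have "exp (real n) \<le> real (\<delta> (C * n))" for n
    proof -
      have "1 \<le> \<epsilon> * real C" using C e by (simp add: field_simps)
      then have "real n \<le> \<epsilon> * real C * real n"
        by (metis mult_1 mult_right_mono of_nat_0_le_iff)
      also have "\<dots> \<le> f (C * n)" using lin[of "C * n"] by (simp add: mult.assoc)
      finally show ?thesis by (simp add: expf)
    qed
    ultimately have "lesssim (\<lambda>n. exp (real n)) (\<lambda>n. real (\<delta> n))"
      unfolding lesssim_def by blast
    with sub show False by (simp add: subexponential_def)
  qed
  then obtain N where N: "f (Suc N) - f N < \<epsilon>" by blast
  have "f n \<le> f N + \<epsilon> * real n" for n
  proof (cases "n \<le> N")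
    case True
    have "real (\<delta> n) \<le> real (\<delta> N)"
      using sub True by (auto simp: subexponential_def mono_def)
    then have "f n \<le> f N" by (simp add: expf)
    moreover have "0 \<le> \<epsilon> * real n" using e by simp
    ultimately show ?thesis by linarith
  next
    case False
    then have "N \<le> n" by simp
    then show ?thesis
    proof (induction n rule: dec_induct)
      case base then show ?case using e by simp
    next
      case (step n)
      then show ?case using N dec[of N n] by (simp add: algebra_simps)
    qed
  qed
  then show ?thesis using that[of "f N"] by (simp add: expf)
qed

text \<open>Half of the exponent absorbs the size of the spheres, the other half leaves a geometric
  series. The bound depends on neither \<open>f\<close> nor \<open>H\<close>, hence will be uniform
  in the index of the group.\<close>

lemma poincare_sum_sphere_bound:
  fixes f :: "'a \<Rightarrow> nat"
  assumes s: "s > 0" and b: "\<And>n. real (\<delta> n) \<le> exp (C + s / 2 * real n)"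
    and H: "finite H" and card: "\<And>n. card {h \<in> H. f h = n} \<le> \<delta> n"
  shows "(\<Sum>h\<in>H. exp (- s * real (f h))) \<le> exp C / (1 - exp (- s / 2))"
proof -
  let ?q = "exp (- s / 2)"
  have q: "0 \<le> ?q" "?q < 1" using s by auto
  have "(\<Sum>h\<in>H. exp (- s * real (f h)))
    = (\<Sum>n\<in>f ` H. \<Sum>h\<in>{h \<in> H. f h = n}. exp (- s * real (f h)))"
    by (rule sum.image_gen[OF H])
  also have "\<dots> = (\<Sum>n\<in>f ` H. real (card {h \<in> H. f h = n}) * exp (- s * real n))"
    by (rule sum.cong) auto
  also have "\<dots> \<le> (\<Sum>n\<in>f ` H. exp C * ?q ^ n)"
  proof (rule sum_mono)
    fix n
    have "real (card {h \<in> H. f h = n}) \<le> exp (C + s / 2 * real n)"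
      using card[of n] b[of n] by linarith
    then have "real (card {h \<in> H. f h = n}) * exp (- s * real n)
      \<le> exp (C + s / 2 * real n) * exp (- s * real n)" by (rule mult_right_mono) simp
    also have "\<dots> = exp C * ?q ^ n"
      by (simp add: exp_add[symmetric] exp_of_nat_mult[symmetric] algebra_simps)
    finally show "real (card {h \<in> H. f h = n}) * exp (- s * real n) \<le> exp C * ?q ^ n" .
  qed
  also have "\<dots> = exp C * (\<Sum>n\<in>f ` H. ?q ^ n)" by (simp add: sum_distrib_left)
  also have "\<dots> \<le> exp C * (1 / (1 - ?q))"
  proof (rule mult_left_mono)
    have "(\<Sum>n\<in>f ` H. ?q ^ n) \<le> (\<Sum>n. ?q ^ n)"
      using q H by (intro sum_le_suminf summable_geometric) auto
    then show "(\<Sum>n\<in>f ` H. ?q ^ n) \<le> 1 / (1 - ?q)"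
      using q by (simp add: suminf_geometric)
  qed simp
  finally show ?thesis by simp
qed

lemma prod_sum_PiE:
  fixes f :: "'a \<Rightarrow> 'b \<Rightarrow> 'c :: comm_semiring_1"
  assumes "finite A"
  shows "(\<Prod>x\<in>A. sum (f x) (B x)) = (\<Sum>c\<in>PiE A B. \<Prod>x\<in>A. f x (c x))"
  using assms
proof (induction A)
  case empty
  then show ?case by simp
next
  case (insert a A)
  have "(\<Sum>c\<in>PiE (insert a A) B. \<Prod>x\<in>insert a A. f x (c x))
    = (\<Sum>(y, c)\<in>B a \<times> PiE A B. \<Prod>x\<in>insert a A. f x ((c(a := y)) x))"
    unfolding PiE_insert_eq using insert.hyps(2)
    by (subst sum.reindex) (auto simp: case_prod_beta intro: inj_combinator)
  also have "\<dots> = (\<Sum>(y, c)\<in>B a \<times> PiE A B. f a y * (\<Prod>x\<in>A. f x (c x)))"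
  proof (rule sum.cong[OF refl], clarify)
    fix y c
    have "(\<Prod>x\<in>A. f x ((c(a := y)) x)) = (\<Prod>x\<in>A. f x (c x))"
      by (rule prod.cong) (use insert.hyps in auto)
    then show "(\<Prod>x\<in>insert a A. f x ((c(a := y)) x)) = f a y * (\<Prod>x\<in>A. f x (c x))"
      using insert.hyps by simp
  qed
  also have "\<dots> = sum (f a) (B a) * (\<Sum>c\<in>PiE A B. \<Prod>x\<in>A. f x (c x))"
    by (simp add: sum_product sum.cartesian_product)
  finally show ?case using insert by simp
qed

text \<open>Any switch from \<open>P\<close> to its negation will do, so \<open>P\<close> need not
  be closed under prefixes.\<close>

lemma split_first_failure:
  assumes "P []" "\<not> P ws"
  obtains xs s ys where "ws = xs @ s # ys" "P xs" "\<not> P (xs @ [s])"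
proof -
  have "\<exists>xs s ys. ws = xs @ s # ys \<and> P xs \<and> \<not> P (xs @ [s])"
    using assms(2)
  proof (induction ws rule: rev_induct)
    case Nil
    then show ?case using assms(1) by simp
  next
    case (snoc s ws)
    then show ?case by (metis append_Cons append_Nil append_assoc)
  qed
  then show ?thesis using that by blast
qed

definition piece_prod :: "(tmap \<times> tmap) list \<Rightarrow> tmap \<Rightarrow> tmap" where
  "piece_prod ps h = foldr (\<lambda>(h, s) f. h \<circ> s \<circ> f) ps h"

section \<open>Similar families and norms at deeper levels\<close>

locale similar_family =
  fixes d :: nat and G S :: "nat \<Rightarrow> tmap set" and L :: "nat \<Rightarrow> tmap \<Rightarrow> nat"
  assumes family: "non_l1_expanding_similar_family d G S L"
begin

abbreviation norm_at :: "nat \<Rightarrow> tmap \<Rightarrow> nat" where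
  "norm_at \<nu> \<equiv> word_norm (L \<nu>) (S \<nu>)"

text \<open>The total norm of the iterated coordinates of \<open>g\<close> at the vertices of level
  \<open>k\<close>, each measured in \<open>G (\<nu> + k)\<close>.\<close>

primrec level_norm :: "nat \<Rightarrow> nat \<Rightarrow> tmap \<Rightarrow> nat" where
  "level_norm 0 \<nu> g = norm_at \<nu> g"
| "level_norm (Suc k) \<nu> g = (\<Sum>i<d. level_norm k (Suc \<nu>) (coord d g i))"

lemma family_facts:
  shows G_aut: "g \<in> G \<nu> \<Longrightarrow> tree_aut d g"
    and finite_S: "finite (S \<nu>)"
    and G_eq: "G \<nu> = generated (S \<nu>)"
    and L_le: "s \<in> S \<nu> \<Longrightarrow> L \<nu> s \<le> 1"
    and finite_L0: "finite (generated {s \<in> S \<nu>. L \<nu> s = 0})"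
    and coord_G: "g \<in> G \<nu> \<Longrightarrow> i < d \<Longrightarrow> coord d g i \<in> G (Suc \<nu>)"
    and coord_norm: "g \<in> G \<nu> \<Longrightarrow> (\<Sum>i<d. norm_at (Suc \<nu>) (coord d g i)) \<le> norm_at \<nu> g"
proof -
  note fam = spec[OF family[unfolded non_l1_expanding_similar_family_def], of \<nu>]
  show "g \<in> G \<nu> \<Longrightarrow> tree_aut d g" "g \<in> G \<nu> \<Longrightarrow> i < d \<Longrightarrow> coord d g i \<in> G (Suc \<nu>)"
    "g \<in> G \<nu> \<Longrightarrow> (\<Sum>i<d. norm_at (Suc \<nu>) (coord d g i)) \<le> norm_at \<nu> g"
    using fam by simp_all
  show "finite (S \<nu>)" "G \<nu> = generated (S \<nu>)"
    using fam by blast+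
  have "proper_pseudolength (L \<nu>) (S \<nu>)" using fam by blast
  then show "s \<in> S \<nu> \<Longrightarrow> L \<nu> s \<le> 1" "finite (generated {s \<in> S \<nu>. L \<nu> s = 0})"
    by (simp_all add: proper_pseudolength_def)
qed

lemma G_comp: "g \<in> G \<nu> \<Longrightarrow> h \<in> G \<nu> \<Longrightarrow> g \<circ> h \<in> G \<nu>"
  by (simp add: G_eq generated_comp)

lemma eval_G: "set ws \<subseteq> S \<nu> \<Longrightarrow> eval_word ws \<in> G \<nu>"
  by (simp add: G_eq generated_eval)

lemma finite_ball: "finite {g \<in> G \<nu>. norm_at \<nu> g \<le> n}"
proof (rule finite_subset)
  show "{g \<in> G \<nu>. norm_at \<nu> g \<le> n}
    \<subseteq> eval_word ` {ws. set ws \<subseteq> S \<nu> \<and> sum_list (map (L \<nu>) ws) \<le> n}"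
  proof safe
    fix g assume "g \<in> G \<nu>" and n: "norm_at \<nu> g \<le> n"
    from this(1)[unfolded G_eq] obtain ws where "set ws \<subseteq> S \<nu>" "eval_word ws = g"
      "sum_list (map (L \<nu>) ws) = norm_at \<nu> g"
      by (rule word_norm_attained)
    with n show "g \<in> eval_word ` {ws. set ws \<subseteq> S \<nu> \<and> sum_list (map (L \<nu>) ws) \<le> n}"
      by auto
  qed
  show "finite (eval_word ` {ws. set ws \<subseteq> S \<nu> \<and> sum_list (map (L \<nu>) ws) \<le> n})"
    by (rule finite_word_sum_ball[OF finite_S finite_L0])
qed

lemma norm_at_le_word_length:
  assumes "g \<in> G \<nu>"
  shows "norm_at \<nu> g \<le> word_norm (\<lambda>_. 1) (S \<nu>) g"
proof -
  obtain ws where ws: "set ws \<subseteq> S \<nu>" "eval_word ws = g"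
    "sum_list (map (\<lambda>_. 1) ws) = word_norm (\<lambda>_. 1) (S \<nu>) g"
    using assms[unfolded G_eq] by (rule word_norm_attained)
  have "norm_at \<nu> g \<le> sum_list (map (L \<nu>) ws)"
    using word_norm_le[OF ws(1)] ws(2) by blast
  also have "\<dots> \<le> sum_list (map (\<lambda>_. 1) ws)"
    by (rule sum_list_mono) (use ws L_le in auto)
  finally show ?thesis using ws(3) by simp
qed

lemma level_norm_le: "g \<in> G \<nu> \<Longrightarrow> level_norm k \<nu> g \<le> norm_at \<nu> g"
proof (induction k arbitrary: \<nu> g)
  case (Suc k)
  have "level_norm (Suc k) \<nu> g \<le> (\<Sum>i<d. norm_at (Suc \<nu>) (coord d g i))"
    by (auto intro!: sum_mono Suc coord_G)
  also have "\<dots> \<le> norm_at \<nu> g" by (rule coord_norm[OF Suc.prems])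
  finally show ?case .
qed simp

lemma level_norm_Suc_le: "g \<in> G \<nu> \<Longrightarrow> level_norm (Suc k) \<nu> g \<le> level_norm k \<nu> g"
proof (induction k arbitrary: \<nu> g)
  case 0
  then show ?case using coord_norm by simp
next
  case (Suc k)
  have "level_norm (Suc (Suc k)) \<nu> g = (\<Sum>i<d. level_norm (Suc k) (Suc \<nu>) (coord d g i))"
    by simp
  also have "\<dots> \<le> (\<Sum>i<d. level_norm k (Suc \<nu>) (coord d g i))"
    by (intro sum_mono Suc.IH coord_G[OF Suc.prems]) simp
  finally show ?case by simp
qed

lemma level_norm_antimono:
  assumes "g \<in> G \<nu>" "j \<le> k"
  shows "level_norm k \<nu> g \<le> level_norm j \<nu> g"
  using assms(2) by (rule lift_Suc_antimono_le[rotated]) (rule level_norm_Suc_le[OF assms(1)])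

text \<open>Subadditivity passes down the levels because coordinates multiply up to a permutation of
  indices, and reindexing along the root permutations does not change the sums.\<close>

lemma level_norm_comp_le:
  "g \<in> G \<nu> \<Longrightarrow> h \<in> G \<nu> \<Longrightarrow> level_norm k \<nu> (g \<circ> h) \<le> level_norm k \<nu> g + level_norm k \<nu> h"
proof (induction k arbitrary: \<nu> g h)
  case 0
  then show ?case unfolding G_eq level_norm.simps by (rule word_norm_comp_le)
next
  case (Suc k)
  note gh = G_comp[OF Suc.prems]
  note aut = G_aut[OF Suc.prems(1)] G_aut[OF Suc.prems(2)] G_aut[OF gh]
  let ?l = "level_norm k (Suc \<nu>)"
  let ?p = "root_perm d (g \<circ> h)" and ?q = "root_perm d h"
  have "level_norm (Suc k) \<nu> (g \<circ> h) = (\<Sum>x<d. ?l (coord d (g \<circ> h) (?p x)))"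
    using sum.reindex_bij_betw[OF root_perm_bij[OF aut(3)],
      of "\<lambda>i. ?l (coord d (g \<circ> h) i)"] by simp
  also have "\<dots> \<le> (\<Sum>x<d. ?l (coord d g (?p x)) + ?l (coord d h (?q x)))"
  proof (rule sum_mono)
    fix x assume "x \<in> {..<d}"
    then have x: "x < d" by simp
    note c = coord_G[OF Suc.prems(1) root_perm_less[OF aut(3) x]]
      coord_G[OF Suc.prems(2) root_perm_less[OF aut(2) x]]
    show "?l (coord d (g \<circ> h) (?p x)) \<le> ?l (coord d g (?p x)) + ?l (coord d h (?q x))"
      unfolding coord_comp[OF aut x G_aut[OF c(2)]] by (rule Suc.IH[OF c])
  qed
  also have "\<dots> = (\<Sum>x<d. ?l (coord d g (?p x))) + (\<Sum>x<d. ?l (coord d h (?q x)))"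
    by (rule sum.distrib)
  also have "\<dots> = level_norm (Suc k) \<nu> g + level_norm (Suc k) \<nu> h"
    using sum.reindex_bij_betw[OF root_perm_bij[OF aut(3)], of "\<lambda>i. ?l (coord d g i)"]
      sum.reindex_bij_betw[OF root_perm_bij[OF aut(2)], of "\<lambda>i. ?l (coord d h i)"] by simp
  finally show ?case .
qed

section \<open>Incompressible elements and factorization of geodesic words\<close>

text \<open>The level norm, the sum of the coordinate norms and the norm form an increasing chain.
  Equality of its ends forces equality throughout, and then in every coordinate, which turns the
  recursive definition into one numerical equation.\<close>

lemma incompr_iff:
  "g \<in> incompr d G S L k \<nu> \<longleftrightarrow> g \<in> G \<nu> \<and> level_norm k \<nu> g = norm_at \<nu> g"
proof (induction k arbitrary: \<nu> g)
  case (Suc k)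
  show ?case
  proof (cases "g \<in> G \<nu>")
    case True
    note c = coord_G[OF True]
    let ?l = "\<lambda>i. level_norm k (Suc \<nu>) (coord d g i)"
    let ?n = "\<lambda>i. norm_at (Suc \<nu>) (coord d g i)"
    have le: "?l i \<le> ?n i" if "i < d" for i using level_norm_le[OF c[OF that]] .
    have "sum ?n {..<d} \<le> norm_at \<nu> g" by (rule coord_norm[OF True])
    moreover have "sum ?l {..<d} \<le> sum ?n {..<d}" using le by (auto intro!: sum_mono)
    moreover have "(sum ?l {..<d} = sum ?n {..<d}) \<longleftrightarrow> (\<forall>i<d. ?l i = ?n i)"
    proof
      assume eq: "sum ?l {..<d} = sum ?n {..<d}"
      show "\<forall>i<d. ?l i = ?n i"
        using sum_mono_inv[of ?l "{..<d}" ?n, OF eq] le by auto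
    qed simp
    ultimately have "((\<forall>i<d. ?l i = ?n i) \<and> sum ?n {..<d} = norm_at \<nu> g)
      \<longleftrightarrow> sum ?l {..<d} = norm_at \<nu> g" by auto
    then show ?thesis using True c by (auto simp: Suc.IH)
  qed simp
qed simp

lemma incompr_inf_subset: "incompr_inf d G S L \<nu> \<subseteq> G \<nu>"
  unfolding incompr_inf_def using incompr_iff by fastforce

lemma id_incompr: "id \<in> incompr_inf d G S L \<nu>"
proof -
  have "id \<in> G \<nu>" using eval_G[of "[]" \<nu>] by simp
  then show ?thesis
    unfolding incompr_inf_def using level_norm_le[of id \<nu>] by (simp add: incompr_iff)
qed

text \<open>The level at which an element stops being incompressible depends on the element,
  but balls are finite.\<close>

lemma compress_level:
  obtains k where "\<forall>g\<in>G \<nu>. norm_at \<nu> g \<le> n \<longrightarrow> g \<notin> incompr_inf d G S L \<nu>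
    \<longrightarrow> level_norm k \<nu> g < norm_at \<nu> g"
proof -
  let ?M = "{g \<in> G \<nu>. norm_at \<nu> g \<le> n} - incompr_inf d G S L \<nu>"
  have fin: "finite ?M" using finite_ball by blast
  have "\<exists>k. level_norm k \<nu> g < norm_at \<nu> g" if g: "g \<in> ?M" for g
  proof -
    obtain k where "g \<notin> incompr d G S L k \<nu>" using g by (auto simp: incompr_inf_def)
    then have "level_norm k \<nu> g \<noteq> norm_at \<nu> g" using g by (simp add: incompr_iff)
    moreover have "level_norm k \<nu> g \<le> norm_at \<nu> g" using g by (intro level_norm_le) simp
    ultimately show ?thesis by (meson le_neq_implies_less)
  qed
  then have "\<forall>g\<in>?M. \<exists>k. level_norm k \<nu> g < norm_at \<nu> g" by blast
  from bchoice[OF this]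
  obtain K where K: "\<And>g. g \<in> ?M \<Longrightarrow> level_norm (K g) \<nu> g < norm_at \<nu> g" by blast
  show ?thesis
  \<comment> \<open>The largest of the individual levels serves all elements, since level norms do
    not increase with the level. For empty \<open>?M\<close> the value is arbitrary and there is
    nothing to check.\<close>
  proof (rule that[of "Max (K ` ?M)"], intro ballI impI)
    fix g assume g: "g \<in> G \<nu>" "norm_at \<nu> g \<le> n" "g \<notin> incompr_inf d G S L \<nu>"
    then have "g \<in> ?M" by simp
    then have "K g \<le> Max (K ` ?M)" using fin by simp
    then show "level_norm (Max (K ` ?M)) \<nu> g < norm_at \<nu> g"
      using level_norm_antimono[OF g(1)] K[OF \<open>g \<in> ?M\<close>] by (meson le_less_trans)
  qed
qed

text \<open>Every factor \<open>h\<^sub>i \<circ> s\<^sub>i\<close> is cut as soon as it is compressible or longer than \<open>R\<close>;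
  either event pays for one unit of \<open>length ps\<close>.\<close>

lemma decomposition:
  assumes k: "\<forall>g\<in>G \<nu>. norm_at \<nu> g \<le> Suc R \<longrightarrow> g \<notin> incompr_inf d G S L \<nu>
      \<longrightarrow> level_norm k \<nu> g < norm_at \<nu> g"
    and "g \<in> G \<nu>"
  shows "\<exists>ps h. set ps \<subseteq> incompr_inf d G S L \<nu> \<times> S \<nu> \<and> h \<in> incompr_inf d G S L \<nu>
    \<and> g = piece_prod ps h \<and> (\<Sum>(h, s)\<leftarrow>ps. norm_at \<nu> h) + norm_at \<nu> h \<le> norm_at \<nu> g
    \<and> Suc R * (level_norm k \<nu> g + length ps) \<le> Suc (Suc R) * norm_at \<nu> g"
proof -
  let ?I = "incompr_inf d G S L \<nu>"
  obtain ws where ws: "set ws \<subseteq> S \<nu>" "eval_word ws = g" "sum_list (map (L \<nu>) ws) = norm_at \<nu> g"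
    using \<open>g \<in> G \<nu>\<close>[unfolded G_eq] by (rule word_norm_attained)
  \<comment> \<open>The induction is on the length of a geodesic word, not on the norm: removing
    letters of length 0 does not lower the norm.\<close>
  then show ?thesis
  proof (induction "length ws" arbitrary: ws g rule: less_induct)
    case less
    note ws = less.prems
    have gG: "g \<in> G \<nu>" using ws eval_G by blast
    show ?case
    proof (cases "g \<in> ?I")
      case True
      have "Suc R * level_norm k \<nu> g \<le> Suc (Suc R) * norm_at \<nu> g"
        using level_norm_le[OF gG] by (intro mult_mono) auto
      with True show ?thesis by (intro exI[of _ "[]"] exI[of _ g]) (simp add: piece_prod_def)
    next
      case False
      \<comment> \<open>A prefix is extended within \<open>P\<close>; the letter \<open>s\<close>
        that leaves \<open>P\<close> closes the piece \<open>u\<close>, whose norm is at most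
        \<open>Suc R\<close> because a letter adds at most 1.\<close>
      define P where "P xs \<longleftrightarrow> eval_word xs \<in> ?I \<and> norm_at \<nu> (eval_word xs) \<le> R" for xs
      have "P []" "\<not> P ws" using False ws(2) by (simp_all add: P_def id_incompr)
      then obtain xs s ys where sp: "ws = xs @ s # ys" "P xs" "\<not> P (xs @ [s])"
        by (rule split_first_failure)
      define u where "u = eval_word (xs @ [s])"
      define g' where "g' = eval_word ys"
      define h where "h = eval_word xs"
      have in_S: "set (xs @ [s]) \<subseteq> S \<nu>" "set ys \<subseteq> S \<nu>" "s \<in> S \<nu>" using ws(1) sp(1) by auto
      have uG: "u \<in> G \<nu>" and g'G: "g' \<in> G \<nu>"
        unfolding u_def g'_def using in_S eval_G by blast+
      have g: "g = u \<circ> g'" using ws(2) sp(1) by (auto simp: u_def g'_def)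
      have geo: "set ((xs @ [s]) @ ys) \<subseteq> S \<nu>" "sum_list (map (L \<nu>) ((xs @ [s]) @ ys))
        = norm_at \<nu> (eval_word ((xs @ [s]) @ ys))"
        using ws sp(1) by auto
      note geo' = geodesic_split[OF geo]
      have nu: "norm_at \<nu> u = sum_list (map (L \<nu>) xs) + L \<nu> s"
        using geo'(1) by (simp add: u_def)
      have ng: "norm_at \<nu> g = norm_at \<nu> u + norm_at \<nu> g'"
        using geo' ws sp(1) by (simp add: u_def g'_def)
      have nh: "norm_at \<nu> h = sum_list (map (L \<nu>) xs)"
        using geodesic_split(1)[OF in_S(1) geo'(1)] by (simp add: h_def)
      have h: "h \<in> ?I" "norm_at \<nu> h \<le> R" using sp(2) by (auto simp: P_def h_def)
      have uR: "norm_at \<nu> u \<le> Suc R" using nu nh h(2) L_le[OF in_S(3)] by simp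
      \<comment> \<open>If \<open>u\<close> is incompressible, then its norm is exactly
        \<open>Suc R\<close> and the factor \<open>Suc (Suc R)\<close> supplies the extra unit.
        Otherwise the level norm has dropped by at least 1, which supplies it.\<close>
      have u_pay: "Suc R * (level_norm k \<nu> u + 1) \<le> Suc (Suc R) * norm_at \<nu> u"
      proof (cases "u \<in> ?I")
        case True
        then have "norm_at \<nu> u = Suc R" using sp(3) uR by (auto simp: P_def u_def)
        then have "level_norm k \<nu> u + 1 \<le> Suc (Suc R)" using level_norm_le[OF uG, of k] by simp
        then have "Suc R * (level_norm k \<nu> u + 1) \<le> Suc R * Suc (Suc R)" by (rule mult_le_mono2)
        then show ?thesis using \<open>norm_at \<nu> u = Suc R\<close> by (simp only: mult.commute)
      next
        case False
        then have "level_norm k \<nu> u + 1 \<le> norm_at \<nu> u" using k uG uR by (simp add: Suc_le_eq)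
        then show ?thesis by (intro mult_le_mono) simp_all
      qed
      have "length ys < length ws" using sp(1) by simp
      then obtain ps h' where IH: "set ps \<subseteq> ?I \<times> S \<nu>" "h' \<in> ?I" "g' = piece_prod ps h'"
        "(\<Sum>(h, s)\<leftarrow>ps. norm_at \<nu> h) + norm_at \<nu> h' \<le> norm_at \<nu> g'"
        "Suc R * (level_norm k \<nu> g' + length ps) \<le> Suc (Suc R) * norm_at \<nu> g'"
        using less.hyps[of ys g'] in_S(2) geo'(2) by (auto simp: g'_def)
      have "Suc R * (level_norm k \<nu> g + length ((h, s) # ps))
        \<le> Suc R * ((level_norm k \<nu> u + 1) + (level_norm k \<nu> g' + length ps))"
        using level_norm_comp_le[OF uG g'G, of k] g by (intro mult_le_mono2) simp
      also have "\<dots> \<le> Suc (Suc R) * norm_at \<nu> u + Suc (Suc R) * norm_at \<nu> g'"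
        using add_mono[OF u_pay IH(5)] by (simp only: distrib_left)
      finally have pay: "Suc R * (level_norm k \<nu> g + length ((h, s) # ps))
        \<le> Suc (Suc R) * norm_at \<nu> g" by (simp only: ng distrib_left)
      have "g = piece_prod ((h, s) # ps) h'"
        using g IH(3) by (simp add: piece_prod_def u_def h_def)
      moreover have "(\<Sum>(h, s)\<leftarrow>(h, s) # ps. norm_at \<nu> h) + norm_at \<nu> h' \<le> norm_at \<nu> g"
        using IH(4) ng nu nh by simp
      moreover have "set ((h, s) # ps) \<subseteq> ?I \<times> S \<nu>" using IH(1) h(1) in_S(3) by auto
      ultimately show ?thesis using pay IH(2) by blast
    qed
  qed
qed

section \<open>Transfer of convergence between levels\<close>

text \<open>The weight of \<open>g\<close> is the product of the weights of its coordinates. Summing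
  over all coordinate tuples gives a product of \<open>d\<close> sums over the next group, each at
  most \<open>B\<close>, while root permutations cost only a finite factor.\<close>

lemma poincare_level:
  assumes "poincare_bounded (G (\<nu> + k)) (norm_at (\<nu> + k)) t"
  shows "poincare_bounded (G \<nu>) (level_norm k \<nu>) t"
  using assms
proof (induction k arbitrary: \<nu>)
  case 0
  have "level_norm 0 \<nu> = norm_at \<nu>" by (rule ext) simp
  with 0 show ?case by simp
next
  case (Suc k)
  let ?l = "level_norm k (Suc \<nu>)"
  have "poincare_bounded (G (Suc \<nu>)) ?l t" using Suc by simp
  then obtain B where B: "\<And>F. finite F \<Longrightarrow> F \<subseteq> G (Suc \<nu>) \<Longrightarrow> (\<Sum>g\<in>F. exp (- t * real (?l g))) \<le> B"
    by (auto simp: poincare_bounded_def)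
  let ?D = "{..<d}"
  let ?R = "PiE ?D (\<lambda>_. ?D)"
  have "(\<Sum>g\<in>F. exp (- t * real (level_norm (Suc k) \<nu> g))) \<le> real (card ?R) * B ^ d"
    if F: "finite F" "F \<subseteq> G \<nu>" for F
  proof -
    let ?C = "\<lambda>i. (\<lambda>g. coord d g i) ` F"
    let ?\<phi> = "\<lambda>g. (restrict (root_perm d g) ?D, restrict (coord d g) ?D)"
    let ?w = "\<lambda>c. \<Prod>i<d. exp (- t * real (?l (c i)))"
    have inj: "inj_on ?\<phi> F"
    proof (rule inj_onI)
      fix g h assume gh: "g \<in> F" "h \<in> F" "?\<phi> g = ?\<phi> h"
      show "g = h"
      proof (rule tree_aut_eqI)
        show "tree_aut d g" "tree_aut d h" using gh F G_aut by blast+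
        have "restrict (root_perm d g) ?D = restrict (root_perm d h) ?D"
          and "restrict (coord d g) ?D = restrict (coord d h) ?D"
          using gh(3) by blast+
        from this[THEN fun_cong] show "root_perm d g x = root_perm d h x"
          and "coord d g x = coord d h x" if "x < d" for x
          using that by (metis lessThan_iff restrict_apply')+
      qed
    qed
    have sub: "?\<phi> ` F \<subseteq> ?R \<times> PiE ?D ?C"
    proof
      fix y assume "y \<in> ?\<phi> ` F"
      then obtain g where g: "g \<in> F" "y = ?\<phi> g" by blast
      then have "tree_aut d g" using F(2) by (blast intro: G_aut)
      then have "restrict (root_perm d g) ?D \<in> ?R"
        by (intro restrict_PiE_iff[THEN iffD2]) (simp add: root_perm_less)
      moreover have "restrict (coord d g) ?D \<in> PiE ?D ?C"
        using g(1) by (intro restrict_PiE_iff[THEN iffD2]) blast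
      ultimately show "y \<in> ?R \<times> PiE ?D ?C" using g(2) by blast
    qed
    have fin: "finite (?R \<times> PiE ?D ?C)" using F by (auto intro!: finite_PiE)
    have "(\<Sum>g\<in>F. exp (- t * real (level_norm (Suc k) \<nu> g))) = (\<Sum>g\<in>F. ?w (snd (?\<phi> g)))"
      by (simp add: sum_distrib_left exp_sum flip: sum_negf)
    also have "\<dots> = (\<Sum>x\<in>?\<phi> ` F. ?w (snd x))"
      by (simp add: sum.reindex[OF inj])
    also have "\<dots> \<le> (\<Sum>x\<in>?R \<times> PiE ?D ?C. ?w (snd x))"
      using fin sub by (intro sum_mono2) (auto intro!: prod_nonneg)
    also have "\<dots> = (\<Sum>p\<in>?R. \<Sum>c\<in>PiE ?D ?C. ?w c)"
      by (simp only: sum.cartesian_product case_prod_unfold)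
    also have "\<dots> = real (card ?R) * (\<Prod>i<d. \<Sum>h\<in>?C i. exp (- t * real (?l h)))"
      by (simp add: prod_sum_PiE)
    also have "\<dots> \<le> real (card ?R) * (\<Prod>i<d. B)"
      using F coord_G by (intro mult_left_mono prod_mono conjI B) (auto intro!: sum_nonneg)
    finally show ?thesis by simp
  qed
  then show ?case by (auto simp: poincare_bounded_def)
qed

lemma poincare_descend:
  assumes "poincare_bounded (G (\<nu> + k)) (norm_at (\<nu> + k)) t" "t \<ge> 0"
  shows "poincare_bounded (G \<nu>) (norm_at \<nu>) t"
  using poincare_level[OF assms(1)]
  by (rule poincare_bounded_mono) (use assms(2) level_norm_le in \<open>auto intro!: mult_left_mono\<close>)

text \<open>An infinite set of indices is unbounded, so every index lies below one of its members
  and inherits convergence from it.\<close>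

lemma poincare_all:
  assumes "infinite N" "\<And>\<nu>. \<nu> \<in> N \<Longrightarrow> poincare_bounded (G \<nu>) (norm_at \<nu>) t" "t \<ge> 0"
  shows "poincare_bounded (G \<nu>) (norm_at \<nu>) t"
proof -
  obtain m where "m \<in> N" "m \<ge> \<nu>"
    using assms(1) by (meson finite_nat_set_iff_bounded not_le)
  then obtain k where "m = \<nu> + k" using le_Suc_ex by blast
  with \<open>m \<in> N\<close> show ?thesis using poincare_descend assms(2,3) by blast
qed

section \<open>Counting products of incompressible pieces\<close>

text \<open>The exponent is split: \<open>s\<close> pays for the incompressible factors,
  \<open>\<tau>\<close> for the number of pieces, which is at most the norm divided by
  \<open>\<beta>\<close> when \<open>\<beta>\<close> is positive. All pairs together then weigh at
  most 1/2, so lists of pairs sum to at most 2, and the final factor contributes at most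
  \<open>X\<close>.\<close>

lemma poincare_few_pieces:
  fixes A :: nat and \<beta> s \<tau> X :: real
  assumes X: "\<And>H. finite H \<Longrightarrow> H \<subseteq> incompr_inf d G S L \<nu>
      \<Longrightarrow> (\<Sum>h\<in>H. exp (- s * real (norm_at \<nu> h))) \<le> X"
    and A: "card (S \<nu>) \<le> A" and pos: "s \<ge> 0" "\<tau> \<ge> 0"
    and half: "real A * X * exp (- \<tau> * \<beta>) \<le> 1/2"
    and M: "\<And>g. g \<in> M \<Longrightarrow> \<exists>ps h. set ps \<subseteq> incompr_inf d G S L \<nu> \<times> S \<nu> \<and> h \<in> incompr_inf d G S L \<nu>
      \<and> g = piece_prod ps h \<and> (\<Sum>(h, s)\<leftarrow>ps. norm_at \<nu> h) + norm_at \<nu> h \<le> norm_at \<nu> g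
      \<and> \<beta> * real (length ps) \<le> real (norm_at \<nu> g)"
  shows "poincare_bounded M (norm_at \<nu>) (s + \<tau>)"
proof -
  let ?I = "incompr_inf d G S L \<nu>"
  define D where "D g p \<longleftrightarrow> set (fst p) \<subseteq> ?I \<times> S \<nu> \<and> snd p \<in> ?I \<and> g = piece_prod (fst p) (snd p)
    \<and> (\<Sum>(h, s)\<leftarrow>fst p. norm_at \<nu> h) + norm_at \<nu> (snd p) \<le> norm_at \<nu> g
    \<and> \<beta> * real (length (fst p)) \<le> real (norm_at \<nu> g)" for g p
  have "\<forall>g\<in>M. \<exists>p. D g p"
  proof
    fix g assume "g \<in> M"
    from M[OF this] obtain ps h where "D g (ps, h)" unfolding D_def by auto
    then show "\<exists>p. D g p" ..
  qed
  from bchoice[OF this] obtain \<phi> where \<phi>: "\<And>g. g \<in> M \<Longrightarrow> D g (\<phi> g)" by blast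
  define ps h where "ps g = fst (\<phi> g)" and "h g = snd (\<phi> g)" for g
  have dec: "\<And>g. g \<in> M \<Longrightarrow> set (ps g) \<subseteq> ?I \<times> S \<nu>" "\<And>g. g \<in> M \<Longrightarrow> h g \<in> ?I"
    "\<And>g. g \<in> M \<Longrightarrow> g = piece_prod (ps g) (h g)"
    "\<And>g. g \<in> M \<Longrightarrow> (\<Sum>(h, s)\<leftarrow>ps g. norm_at \<nu> h) + norm_at \<nu> (h g) \<le> norm_at \<nu> g"
    "\<And>g. g \<in> M \<Longrightarrow> \<beta> * real (length (ps g)) \<le> real (norm_at \<nu> g)"
    using \<phi> unfolding D_def ps_def h_def by blast+
  \<comment> \<open>Each pair carries its share \<open>exp (- \<tau> * \<beta>)\<close> of the cost
    of the list length, which makes the weight multiplicative along lists.\<close>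
  define w where "w = (\<lambda>(h, s' :: tmap). exp (- \<tau> * \<beta>) * exp (- s * real (norm_at \<nu> h)))"
  define e where "e h = exp (- s * real (norm_at \<nu> h))" for h
  have w_list: "prod_list (map w qs)
    = exp (- \<tau> * (\<beta> * real (length qs)) - s * real (\<Sum>(h, s)\<leftarrow>qs. norm_at \<nu> h))" for qs
  proof (induction qs)
    case (Cons q qs)
    obtain a b where "q = (a, b)" by (cases q)
    with Cons show ?case
      by (simp add: w_def exp_add[symmetric]) (simp add: algebra_simps)
  qed simp
  have "(\<Sum>g\<in>F. exp (- (s + \<tau>) * real (norm_at \<nu> g))) \<le> 2 * X" if F: "finite F" "F \<subseteq> M" for F
  proof -
    let ?\<phi> = "\<lambda>g. (ps g, h g)"
    \<comment> \<open>Only finitely many incompressible elements and list lengths occur in the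
      factorizations of \<open>F\<close>, so the bound \<open>X\<close> and the bound for lists
      apply.\<close>
    define H where "H = fst ` (\<Union>g\<in>F. set (ps g)) \<union> h ` F"
    define m where "m = Max ((length \<circ> ps) ` F)"
    let ?U = "{qs. set qs \<subseteq> H \<times> S \<nu> \<and> length qs \<le> m}"
    have H: "finite H" "H \<subseteq> ?I"
    proof -
      show "finite H" using F(1) by (simp add: H_def)
      have "set (ps g) \<subseteq> ?I \<times> S \<nu>" "h g \<in> ?I" if "g \<in> F" for g
        using dec(1,2) F(2) that by blast+
      then have "fst ` set (ps g) \<subseteq> ?I" "h g \<in> ?I" if "g \<in> F" for g
        using that by fastforce+
      then show "H \<subseteq> ?I" unfolding H_def image_UN by blast
    qed
    have X0: "sum e H \<le> X" unfolding e_def by (rule X[OF H])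
    have "0 \<le> sum e H" by (auto intro!: sum_nonneg simp: e_def)
    have finU: "finite ?U" using H(1) finite_S by (intro finite_lists_length_le) auto
    have inj: "inj_on ?\<phi> F"
    proof (rule inj_onI)
      fix g g' assume "g \<in> F" "g' \<in> F" and eq: "?\<phi> g = ?\<phi> g'"
      then have "g = piece_prod (ps g) (h g)" "g' = piece_prod (ps g') (h g')"
        using F(2) dec(3) by blast+
      moreover have "ps g = ps g'" "h g = h g'" using eq by simp_all
      ultimately show "g = g'" by (simp only:)
    qed
    have sub: "?\<phi> ` F \<subseteq> ?U \<times> H"
    proof
      fix x assume "x \<in> ?\<phi> ` F"
      then obtain g where g: "g \<in> F" "x = ?\<phi> g" by blast
      have "length (ps g) \<le> m" unfolding m_def using g F by (intro Max_ge) auto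
      moreover have "set (ps g) \<subseteq> H \<times> S \<nu>"
      proof
        fix q assume q: "q \<in> set (ps g)"
        then have "fst q \<in> H" using g(1) unfolding H_def image_UN by blast
        moreover have "set (ps g) \<subseteq> ?I \<times> S \<nu>" using dec(1) F(2) g(1) by blast
        ultimately show "q \<in> H \<times> S \<nu>" using q by (auto simp: mem_Times_iff)
      qed
      ultimately show "x \<in> ?U \<times> H" using g by (auto simp: H_def)
    qed
    have "sum w (H \<times> S \<nu>) = exp (- \<tau> * \<beta>) * (sum e H * real (card (S \<nu>)))"
      unfolding w_def e_def sum.cartesian_product[symmetric]
      by (simp add: sum_distrib_left sum_distrib_right mult_ac)
    also have "\<dots> \<le> exp (- \<tau> * \<beta>) * (X * real A)"
      using X0 A \<open>0 \<le> sum e H\<close> by (intro mult_left_mono mult_mono) auto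
    also have "\<dots> \<le> 1/2" using half by (simp add: mult_ac)
    finally have w_half: "sum w (H \<times> S \<nu>) \<le> 1/2" .
    have "(\<Sum>g\<in>F. exp (- (s + \<tau>) * real (norm_at \<nu> g)))
      \<le> (\<Sum>g\<in>F. prod_list (map w (ps g)) * e (h g))"
    proof (rule sum_mono)
      fix g assume "g \<in> F"
      then have g: "g \<in> M" using F by blast
      have "real ((\<Sum>(h, s)\<leftarrow>ps g. norm_at \<nu> h) + norm_at \<nu> (h g)) \<le> real (norm_at \<nu> g)"
        using dec(4)[OF g] of_nat_mono by blast
      then have "s * (real (\<Sum>(h, s)\<leftarrow>ps g. norm_at \<nu> h) + real (norm_at \<nu> (h g))) \<le> s * real (norm_at \<nu> g)"
        using pos by (intro mult_left_mono) auto
      moreover have "\<tau> * (\<beta> * real (length (ps g))) \<le> \<tau> * real (norm_at \<nu> g)"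
        using dec(5)[OF g] pos by (intro mult_left_mono) auto
      ultimately show "exp (- (s + \<tau>) * real (norm_at \<nu> g)) \<le> prod_list (map w (ps g)) * e (h g)"
        unfolding w_list e_def by (simp add: exp_add[symmetric] algebra_simps)
    qed
    also have "\<dots> = (\<Sum>(qs, h)\<in>?\<phi> ` F. prod_list (map w qs) * e h)"
      by (simp add: sum.reindex[OF inj])
    also have "\<dots> \<le> (\<Sum>(qs, h)\<in>?U \<times> H. prod_list (map w qs) * e h)"
      using finU H sub by (intro sum_mono2) (auto simp: w_list e_def)
    also have "\<dots> = (\<Sum>qs\<in>?U. prod_list (map w qs)) * sum e H"
      by (simp add: sum_product sum.cartesian_product)
    also have "\<dots> \<le> 2 * X"
    proof (rule mult_mono[OF _ X0])
      show "(\<Sum>qs\<in>?U. prod_list (map w qs)) \<le> 2"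
        using H(1) finite_S w_half by (intro sum_prod_list_le_2) (auto simp: w_def)
    qed (use \<open>0 \<le> sum e H\<close> in auto)
    finally show ?thesis .
  qed
  then show ?thesis by (auto simp: poincare_bounded_def)
qed

text \<open>The case \<open>R = 0\<close> of the factorization bounds the number of pieces by twice
  the norm, without any assumed convergence. This provides the first admissible exponent.\<close>

lemma poincare_some:
  fixes A :: nat and X :: real
  assumes X: "\<And>H. finite H \<Longrightarrow> H \<subseteq> incompr_inf d G S L \<nu>
      \<Longrightarrow> (\<Sum>h\<in>H. exp (- s * real (norm_at \<nu> h))) \<le> X"
    and A: "card (S \<nu>) \<le> A" and pos: "s \<ge> 0" "\<tau> \<ge> 0"
    and half: "real A * X * exp (- \<tau> * (1/2)) \<le> 1/2"
  shows "poincare_bounded (G \<nu>) (norm_at \<nu>) (s + \<tau>)"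
proof (rule poincare_few_pieces[OF X A pos half])
  fix g assume g: "g \<in> G \<nu>"
  obtain k where k: "\<forall>g\<in>G \<nu>. norm_at \<nu> g \<le> Suc 0 \<longrightarrow> g \<notin> incompr_inf d G S L \<nu>
    \<longrightarrow> level_norm k \<nu> g < norm_at \<nu> g"
    by (rule compress_level)
  obtain ps h where ph: "set ps \<subseteq> incompr_inf d G S L \<nu> \<times> S \<nu>" "h \<in> incompr_inf d G S L \<nu>"
    "g = piece_prod ps h" "(\<Sum>(h, s)\<leftarrow>ps. norm_at \<nu> h) + norm_at \<nu> h \<le> norm_at \<nu> g"
    "Suc 0 * (level_norm k \<nu> g + length ps) \<le> Suc (Suc 0) * norm_at \<nu> g"
    using decomposition[OF k g] by blast
  from ph(5) have "1/2 * real (length ps) \<le> real (norm_at \<nu> g)" by simp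
  with ph(1-4) show "\<exists>ps h. set ps \<subseteq> incompr_inf d G S L \<nu> \<times> S \<nu> \<and> h \<in> incompr_inf d G S L \<nu>
      \<and> g = piece_prod ps h \<and> (\<Sum>(h, s)\<leftarrow>ps. norm_at \<nu> h) + norm_at \<nu> h \<le> norm_at \<nu> g
      \<and> 1/2 * real (length ps) \<le> real (norm_at \<nu> g)" by blast
qed

text \<open>Either level \<open>k\<close> loses a proportion 1 / (R + 1) of the norm, and the
  exponent \<open>t\<close> improves by the factor R / (R + 1), or the factorization has few pieces.
  The level \<open>k\<close> depends on \<open>\<nu>\<close>, so convergence at \<open>t\<close> is
  assumed for every index, whereas the gain depends on \<open>R\<close> only.\<close>

lemma poincare_improve:
  fixes A R :: nat and X :: real
  assumes X: "\<And>H. finite H \<Longrightarrow> H \<subseteq> incompr_inf d G S L \<nu>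
      \<Longrightarrow> (\<Sum>h\<in>H. exp (- s * real (norm_at \<nu> h))) \<le> X"
    and A: "card (S \<nu>) \<le> A" and s: "s \<ge> 0"
    and half: "real A * X * exp (- s * (real (Suc R) / 2)) \<le> 1/2"
    and t: "\<And>\<mu>. poincare_bounded (G \<mu>) (norm_at \<mu>) t"
    and t': "t' \<ge> 2 * s" "real R * t \<le> real (Suc R) * t'" "t \<ge> 0"
  shows "poincare_bounded (G \<nu>) (norm_at \<nu>) t'"
proof -
  obtain k where k: "\<forall>g\<in>G \<nu>. norm_at \<nu> g \<le> Suc R \<longrightarrow> g \<notin> incompr_inf d G S L \<nu>
    \<longrightarrow> level_norm k \<nu> g < norm_at \<nu> g"
    by (rule compress_level)
  define M where "M = {g \<in> G \<nu>. Suc R * level_norm k \<nu> g \<le> R * norm_at \<nu> g}"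
  have "poincare_bounded M (level_norm k \<nu>) t"
    using poincare_level[OF t, of \<nu> k] by (rule poincare_bounded_subset) (auto simp: M_def)
  then have 1: "poincare_bounded M (norm_at \<nu>) t'"
  proof (rule poincare_bounded_mono)
    fix g assume "g \<in> M"
    then have "real (Suc R * level_norm k \<nu> g) \<le> real (R * norm_at \<nu> g)"
      unfolding M_def by (intro of_nat_mono) blast
    then have "real (Suc R) * real (level_norm k \<nu> g) \<le> real R * real (norm_at \<nu> g)"
      by (simp only: of_nat_mult)
    then have "t * (real (Suc R) * real (level_norm k \<nu> g)) \<le> t * (real R * real (norm_at \<nu> g))"
      using t'(3) by (rule mult_left_mono)
    also have "\<dots> = (real R * t) * real (norm_at \<nu> g)" by simp
    also have "\<dots> \<le> (real (Suc R) * t') * real (norm_at \<nu> g)"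
      using t'(2) by (rule mult_right_mono) simp
    finally have "real (Suc R) * (t * real (level_norm k \<nu> g))
      \<le> real (Suc R) * (t' * real (norm_at \<nu> g))" by (simp only: mult_ac)
    then show "t * real (level_norm k \<nu> g) \<le> t' * real (norm_at \<nu> g)"
      by (rule mult_left_le_imp_le) simp
  qed
  have "A * X * exp (- (t' - s) * (real (Suc R) / 2)) \<le> A * X * exp (- s * (real (Suc R) / 2))"
  proof (rule mult_left_mono)
    have "s * (real (Suc R) / 2) \<le> (t' - s) * (real (Suc R) / 2)"
      using t'(1) by (intro mult_right_mono) auto
    then show "exp (- (t' - s) * (real (Suc R) / 2)) \<le> exp (- s * (real (Suc R) / 2))"
      by (simp only: exp_le_cancel_iff mult_minus_left neg_le_iff_le)
    show "0 \<le> A * X" using X[of "{}"] by simp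
  qed
  with half have half': "A * X * exp (- (t' - s) * (real (Suc R) / 2)) \<le> 1/2" by linarith
  \<comment> \<open>The part \<open>t' - s\<close> pays for the number of pieces; it is at least
    \<open>s\<close> because \<open>t' \<ge> 2 * s\<close>.\<close>
  have "poincare_bounded (G \<nu> - M) (norm_at \<nu>) (s + (t' - s))"
  proof (rule poincare_few_pieces[OF X A s _ half'])
    show "0 \<le> t' - s" using t'(1) s by simp
    fix g assume gM: "g \<in> G \<nu> - M"
    then have g: "g \<in> G \<nu>" by simp
    obtain ps h where ph: "set ps \<subseteq> incompr_inf d G S L \<nu> \<times> S \<nu>" "h \<in> incompr_inf d G S L \<nu>"
      "g = piece_prod ps h" "(\<Sum>(h, s)\<leftarrow>ps. norm_at \<nu> h) + norm_at \<nu> h \<le> norm_at \<nu> g"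
      "Suc R * (level_norm k \<nu> g + length ps) \<le> Suc (Suc R) * norm_at \<nu> g"
      using decomposition[OF k g] by blast
    have "R * norm_at \<nu> g < Suc R * level_norm k \<nu> g" using gM by (auto simp add: M_def not_le)
    \<comment> \<open>Outside \<open>M\<close> the level norm uses up more than \<open>R\<close> of
      the \<open>R + 2\<close> multiples of the norm allowed by the factorization, leaving less than
      2 for the pieces.\<close>
    with ph(5) have "Suc R * length ps \<le> 2 * norm_at \<nu> g"
      by (simp only: distrib_left mult_Suc)
    then have "real (Suc R * length ps) \<le> real (2 * norm_at \<nu> g)" by (rule of_nat_mono)
    then have "real (Suc R) / 2 * real (length ps) \<le> real (norm_at \<nu> g)"
      by (simp add: algebra_simps)
    with ph(1-4) show "\<exists>ps h. set ps \<subseteq> incompr_inf d G S L \<nu> \<times> S \<nu> \<and> h \<in> incompr_inf d G S L \<nu>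
      \<and> g = piece_prod ps h \<and> (\<Sum>(h, s)\<leftarrow>ps. norm_at \<nu> h) + norm_at \<nu> h \<le> norm_at \<nu> g
      \<and> real (Suc R) / 2 * real (length ps) \<le> real (norm_at \<nu> g)" by blast
  qed
  then have "poincare_bounded (G \<nu> - M) (norm_at \<nu>) t'" by simp
  with 1 have "poincare_bounded (M \<union> (G \<nu> - M)) (norm_at \<nu>) t'"
    by (rule poincare_bounded_Un)
  moreover have "M \<union> (G \<nu> - M) = G \<nu>" unfolding M_def by blast
  ultimately show ?thesis by (simp only:)
qed

section \<open>From Poincare series to growth\<close>

text \<open>Letters have length at most 1, so each element of the word-length ball of radius
  \<open>n\<close> contributes at least \<open>exp (- t * n)\<close> to the series.\<close>

lemma subexp_growth_if_poincare:
  assumes Q: "\<And>t. t > 0 \<Longrightarrow> poincare_bounded (G \<nu>) (norm_at \<nu>) t"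
  shows "subexp_growth (G \<nu>) (S \<nu>)"
proof -
  let ?B = "\<lambda>n. {g \<in> G \<nu>. word_norm (\<lambda>_. 1) (S \<nu>) g \<le> n}"
  have fin: "finite (?B n)" for n
    unfolding G_eq by (rule finite_word_length_ball[OF finite_S])
  have bound: "\<exists>C. \<forall>n. real (growth (G \<nu>) (S \<nu>) n) \<le> C * exp (t * real n)" if t: "t > 0" for t
  proof -
    obtain C where C: "\<And>F. finite F \<Longrightarrow> F \<subseteq> G \<nu> \<Longrightarrow> (\<Sum>g\<in>F. exp (- t * real (norm_at \<nu> g))) \<le> C"
      using Q[OF t] by (auto simp: poincare_bounded_def)
    have "real (growth (G \<nu>) (S \<nu>) n) \<le> C * exp (t * real n)" for n
    proof -
      have "real (growth (G \<nu>) (S \<nu>) n) * exp (- t * real n) = (\<Sum>g\<in>?B n. exp (- t * real n))"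
        by (simp add: growth_def)
      also have "\<dots> \<le> (\<Sum>g\<in>?B n. exp (- t * real (norm_at \<nu> g)))"
      proof (rule sum_mono)
        fix g assume "g \<in> ?B n"
        then have "norm_at \<nu> g \<le> n" using norm_at_le_word_length[of g \<nu>] by auto
        then show "exp (- t * real n) \<le> exp (- t * real (norm_at \<nu> g))" using t by simp
      qed
      also have "\<dots> \<le> C" by (rule C[OF fin]) auto
      finally show ?thesis by (simp add: exp_minus field_simps)
    qed
    then show ?thesis by blast
  qed
  have "mono (\<lambda>n. real (growth (G \<nu>) (S \<nu>) n))"
    unfolding growth_def by (intro monoI of_nat_mono card_mono fin) auto
  moreover have "lesssim (\<lambda>n. real (growth (G \<nu>) (S \<nu>) n)) (\<lambda>n. exp (real n))"
  proof -
    obtain C where C: "\<And>n. real (growth (G \<nu>) (S \<nu>) n) \<le> C * exp (1 * real n)"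
      using bound[of 1] by auto
    \<comment> \<open>In the dilation \<open>Suc K\<close>, \<open>K\<close> absorbs the constant
      \<open>C\<close> for \<open>n \<ge> 1\<close> and the extra 1 is the exponent.\<close>
    obtain K :: nat where K: "C \<le> real K" using real_arch_simple by blast
    have "real (growth (G \<nu>) (S \<nu>) n) \<le> exp (real (Suc K * n))" if "n \<ge> 1" for n
    proof -
      have "real K \<le> exp (real K)" using exp_ge_add_one_self[of "real K"] by linarith
      also have "\<dots> \<le> exp (real (K * n))"
        using that by (simp del: of_nat_mult)
      finally have "C * exp (1 * real n) \<le> exp (real (K * n)) * exp (1 * real n)"
        using K by (intro mult_right_mono) auto
      also have "\<dots> = exp (real (Suc K * n))" by (simp add: exp_add[symmetric] algebra_simps)
      finally show ?thesis using C[of n] by linarith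
    qed
    then show ?thesis unfolding lesssim_def by blast
  qed
  moreover have "\<not> lesssim (\<lambda>n. exp (real n)) (\<lambda>n. real (growth (G \<nu>) (S \<nu>) n))"
  proof
    assume "lesssim (\<lambda>n. exp (real n)) (\<lambda>n. real (growth (G \<nu>) (S \<nu>) n))"
    then obtain K :: nat where K: "K > 0" "\<And>n. n \<ge> 1 \<Longrightarrow> exp (real n) \<le> real (growth (G \<nu>) (S \<nu>) (K * n))"
      by (auto simp: lesssim_def)
    \<comment> \<open>The exponent 1 / (2K) undoes the dilation by \<open>K\<close> with a factor
      1/2 to spare, so \<open>exp (n / 2)\<close> would be bounded.\<close>
    obtain C where C: "\<And>n. real (growth (G \<nu>) (S \<nu>) n) \<le> C * exp (1 / (2 * real K) * real n)"
      using bound[of "1 / (2 * real K)"] K(1) by auto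
    have le: "real n / 2 \<le> C" if "n \<ge> 1" for n :: nat
    proof -
      have "exp (real n) \<le> C * exp (1 / (2 * real K) * real (K * n))"
        using K(2)[OF that] C[of "K * n"] by linarith
      also have "1 / (2 * real K) * real (K * n) = real n / 2" using K(1) by simp
      finally have "exp (real n / 2) * exp (real n / 2) \<le> C * exp (real n / 2)"
        by (simp add: exp_add[symmetric])
      then have "exp (real n / 2) \<le> C" by simp
      then show ?thesis using exp_ge_add_one_self[of "real n / 2"] by linarith
    qed
    obtain n :: nat where "real n > 2 * C" using reals_Archimedean2 by blast
    then show False using le[of "Suc n"] by simp
  qed
  ultimately show ?thesis by (simp add: subexp_growth_def subexponential_def)
qed

section \<open>The critical exponent vanishes\<close>

lemma poincare_all_exponents:
  fixes A :: nat
  assumes A: "\<And>\<nu>. card (S \<nu>) \<le> A" and N: "infinite N"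
    and X: "\<And>s. s > 0 \<Longrightarrow> \<exists>X. \<forall>\<nu>\<in>N. \<forall>H. finite H \<and> H \<subseteq> incompr_inf d G S L \<nu>
      \<longrightarrow> (\<Sum>h\<in>H. exp (- s * real (norm_at \<nu> h))) \<le> X"
    and t: "t > 0"
  shows "poincare_bounded (G \<nu>) (norm_at \<nu>) t"
proof -
  \<comment> \<open>An exponent counts only if it works for all indices at once, as
    \<open>poincare_improve\<close> requires.\<close>
  define T where "T = {t. t > 0 \<and> (\<forall>\<mu>. poincare_bounded (G \<mu>) (norm_at \<mu>) t)}"
  have small: "\<exists>n::nat. a * exp (- c * real n) \<le> 1/2" if "c > 0" for a c :: real
  proof -
    obtain n :: nat where n: "2 * \<bar>a\<bar> / c < real n" using reals_Archimedean2 by blast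
    have "2 * \<bar>a\<bar> \<le> c * real n" using n that by (simp add: field_simps)
    also have "\<dots> \<le> exp (c * real n)" using exp_ge_add_one_self[of "c * real n"] by linarith
    finally have "a \<le> 1/2 * exp (c * real n)" by linarith
    then have "a * exp (- c * real n) \<le> 1/2" by (simp add: exp_minus field_simps)
    then show ?thesis by blast
  qed
  have "T \<noteq> {}"
  proof -
    obtain X1 where X1: "\<And>\<nu> H. \<nu> \<in> N \<Longrightarrow> finite H \<Longrightarrow> H \<subseteq> incompr_inf d G S L \<nu>
      \<Longrightarrow> (\<Sum>h\<in>H. exp (- 1 * real (norm_at \<nu> h))) \<le> X1"
      using X[of 1] by auto
    obtain n :: nat where n: "A * X1 * exp (- (1/2) * real n) \<le> 1/2" using small[of "1/2"] by auto
    have "poincare_bounded (G \<mu>) (norm_at \<mu>) (1 + real n)" for \<mu>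
      using N
    proof (rule poincare_all)
      fix \<nu> assume "\<nu> \<in> N"
      show "poincare_bounded (G \<nu>) (norm_at \<nu>) (1 + real n)"
        by (rule poincare_some[OF X1[OF \<open>\<nu> \<in> N\<close>] A]) (use n in \<open>auto simp: mult_ac\<close>)
    qed simp
    then have "1 + real n \<in> T" by (simp add: T_def)
    then show ?thesis by blast
  qed
  have bdd: "bdd_below T" by (rule bdd_belowI[of _ 0]) (auto simp: T_def)
  have "Inf T \<ge> 0" by (rule cInf_greatest[OF \<open>T \<noteq> {}\<close>]) (auto simp: T_def)
  have "Inf T = 0"
  proof (rule ccontr)
    assume "Inf T \<noteq> 0"
    with \<open>Inf T \<ge> 0\<close> have T0: "Inf T > 0" by simp
    \<comment> \<open>With this choice the lower limit \<open>2 * s\<close> on new exponents stays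
      strictly below \<open>Inf T\<close>.\<close>
    define s where "s = Inf T / 4"
    have s: "s > 0" using T0 by (simp add: s_def)
    obtain Y where Y: "\<And>\<nu> H. \<nu> \<in> N \<Longrightarrow> finite H \<Longrightarrow> H \<subseteq> incompr_inf d G S L \<nu>
      \<Longrightarrow> (\<Sum>h\<in>H. exp (- s * real (norm_at \<nu> h))) \<le> Y"
      using X[OF s] by auto
    obtain R :: nat where R: "A * Y * exp (- (s / 2) * real R) \<le> 1/2"
      using small[of "s / 2"] s by auto
    have Y0: "0 \<le> A * Y"
    proof -
      obtain \<nu> where "\<nu> \<in> N" using N by fastforce
      then show ?thesis using Y[of \<nu> "{}"] by simp
    qed
    have half: "A * Y * exp (- s * (real (Suc R) / 2)) \<le> 1/2"
    proof -
      have "exp (- s * (real (Suc R) / 2)) \<le> exp (- (s / 2) * real R)"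
        using s by (simp add: field_simps)
      then have "A * Y * exp (- s * (real (Suc R) / 2)) \<le> A * Y * exp (- (s / 2) * real R)"
        using Y0 by (rule mult_left_mono)
      with R show ?thesis by linarith
    qed
    \<comment> \<open>\<open>R\<close> is fixed before \<open>t\<close>, so \<open>t\<close> may be
      taken this close to \<open>Inf T\<close>; since R (R + 2) < (R + 1)^2, the improved exponent
      falls below \<open>Inf T\<close>.\<close>
    have "Inf T < Inf T * (1 + 1 / real (Suc R))" using T0 by (simp add: field_simps)
    then obtain t where tT: "t \<in> T" and t: "t < Inf T * (1 + 1 / real (Suc R))"
      using \<open>T \<noteq> {}\<close> bdd by (meson cInf_less_iff)
    define t' where "t' = max (real R * t / real (Suc R)) (2 * s)"
    have t'0: "t' > 0" using s by (simp add: t'_def)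
    have "poincare_bounded (G \<mu>) (norm_at \<mu>) t'" for \<mu>
      using N
    proof (rule poincare_all)
      fix \<nu> assume "\<nu> \<in> N"
      have "real R * t / real (Suc R) \<le> t'" by (simp add: t'_def)
      then have "real R * t \<le> real (Suc R) * t'" by (simp add: field_simps)
      then show "poincare_bounded (G \<nu>) (norm_at \<nu>) t'"
        using s tT half
        by (intro poincare_improve[OF Y[OF \<open>\<nu> \<in> N\<close>] A, of R t]) (auto simp: T_def t'_def)
    qed (use t'0 in simp)
    then have "t' \<in> T" using t'0 by (simp add: T_def)
    then have "Inf T \<le> t'" using bdd by (rule cInf_lower)
    moreover have "2 * s < Inf T" using T0 by (simp add: s_def)
    moreover have "real R * t / real (Suc R) < Inf T"
    proof -
      let ?r = "real (Suc R)"
      have "real R * t \<le> real R * (Inf T * (1 + 1 / ?r))" using t by (intro mult_left_mono) auto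
      also have "\<dots> = Inf T * (real R * (?r + 1) / ?r)" by (simp add: field_simps)
      also have "\<dots> < Inf T * ?r"
        using T0 by (intro mult_strict_left_mono) (simp_all add: field_simps)
      finally show ?thesis by (simp add: field_simps)
    qed
    ultimately show False by (simp add: t'_def)
  qed
  with t obtain u where "u \<in> T" "u < t"
    using \<open>T \<noteq> {}\<close> bdd by (metis cInf_less_iff)
  then show ?thesis using poincare_bounded_mono_exponent[of "G \<nu>" "norm_at \<nu>" u t] by (simp add: T_def)
qed

end

theorem mainTheorem4:
  fixes d A :: nat
    and G S :: "nat \<Rightarrow> (nat list \<Rightarrow> nat list) set"
    and L :: "nat \<Rightarrow> (nat list \<Rightarrow> nat list) \<Rightarrow> nat"
  assumes "d \<ge> 2"
    and "non_l1_expanding_similar_family d G S L"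
    and "\<forall>\<nu>. S \<nu> \<subseteq> incompr_inf d G S L \<nu>"
    and "\<forall>\<nu>. card (S \<nu>) \<le> A"
    and "\<exists>\<delta> :: nat \<Rightarrow> nat. subexponential (\<lambda>n. real (\<delta> n)) \<and> (\<forall>n. \<delta> n > 0)
           \<and> concave_seq (\<lambda>n. ln (real (\<delta> n)))
           \<and> infinite {\<nu>. \<forall>n. card (incompr_inf d G S L \<nu> \<inter> sphere_pn (G \<nu>) (L \<nu>) (S \<nu>) n) \<le> \<delta> n}"
  shows "\<forall>\<nu>. subexp_growth (G \<nu>) (S \<nu>)"
proof
  fix \<nu>
  interpret similar_family d G S L by unfold_locales fact
  obtain \<delta> :: "nat \<Rightarrow> nat" where \<delta>: "subexponential (\<lambda>n. real (\<delta> n))" "\<And>n. \<delta> n > 0"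
    "concave_seq (\<lambda>n. ln (real (\<delta> n)))"
    and inf: "infinite {\<nu>. \<forall>n. card (incompr_inf d G S L \<nu>
      \<inter> sphere_pn (G \<nu>) (L \<nu>) (S \<nu>) n) \<le> \<delta> n}"
    using assms(5) by blast
  show "subexp_growth (G \<nu>) (S \<nu>)"
  proof (intro subexp_growth_if_poincare poincare_all_exponents[OF _ inf])
    show "card (S \<nu>) \<le> A" for \<nu> using assms(4) by blast
    fix s :: real assume s: "s > 0"
    then have "s / 2 > 0" by simp
    with \<delta> obtain C where C: "\<And>n. real (\<delta> n) \<le> exp (C + s / 2 * real n)"
      using concave_subexponential_bound[of \<delta> "s / 2"] by blast
    show "\<exists>X. \<forall>\<nu>\<in>{\<nu>. \<forall>n. card (incompr_inf d G S L \<nu> \<inter> sphere_pn (G \<nu>) (L \<nu>) (S \<nu>) n) \<le> \<delta> n}.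
      \<forall>H. finite H \<and> H \<subseteq> incompr_inf d G S L \<nu>
        \<longrightarrow> (\<Sum>h\<in>H. exp (- s * real (norm_at \<nu> h))) \<le> X"
    proof (intro exI ballI allI impI)
      fix \<nu> H
      assume \<nu>: "\<nu> \<in> {\<nu>. \<forall>n. card (incompr_inf d G S L \<nu> \<inter> sphere_pn (G \<nu>) (L \<nu>) (S \<nu>) n) \<le> \<delta> n}"
        and H: "finite H \<and> H \<subseteq> incompr_inf d G S L \<nu>"
      show "(\<Sum>h\<in>H. exp (- s * real (norm_at \<nu> h))) \<le> exp C / (1 - exp (- s / 2))"
      proof (rule poincare_sum_sphere_bound[OF s C])
        show "card {h \<in> H. norm_at \<nu> h = n} \<le> \<delta> n" for n
        proof -
          \<comment> \<open>Finiteness matters because \<open>card\<close> of an infinite set is 0,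
            and a bound on it would then say nothing about subsets.\<close>
          have "finite (sphere_pn (G \<nu>) (L \<nu>) (S \<nu>) n)"
            by (rule finite_subset[OF _ finite_ball[of \<nu> n]]) (auto simp: sphere_pn_def)
          then have "card {h \<in> H. norm_at \<nu> h = n}
            \<le> card (incompr_inf d G S L \<nu> \<inter> sphere_pn (G \<nu>) (L \<nu>) (S \<nu>) n)"
            using H incompr_inf_subset[of \<nu>] by (intro card_mono) (auto simp: sphere_pn_def)
          also have "\<dots> \<le> \<delta> n" using \<nu> by blast
          finally show ?thesis .
        qed
      qed (use H in simp)
    qed
  qed
qed

end
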